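(* Let $F(x):=f(x)+\mu\|x\|_1$ on $\mathbb{R}^n$, where $f:\mathbb{R}^n\to\mathbb{R}$ is of class $\mathcal{C}^2$ and $\mu>0$, and let $\bar x\in\mathbb{R}^n$ satisfy $0\in\partial F(\bar x)$. Let $$I:=\{i\mid\bar x_i=0,\ -\mu<(\nabla f(\bar x))_i<\mu\},\quad J:=\{i\mid\bar x_i\neq0,\ (\nabla f(\bar x))_i+\mu\,\mathrm{sign}(\bar x_i)=0\},$$ $$K^+:=\{i\mid\bar x_i=0,\ (\nabla f(\bar x))_i=\mu\},\quad K^-:=\{i\mid\bar x_i=0,\ (\nabla f(\bar x))_i=-\mu\},$$ $$\mathcal{V}(\bar x):=\{w\in\mathbb{R}^n\mid w_j=0\ \forall j\in I,\ w_j\le0\ \forall j\in K^+,\ w_j\ge0\ \forall j\in K^-\}.$$ Assume that $D(\partial F)(\bar x\mid0)^{-1}(0)=\{0\}$, or equivalently that the following implication holds for $w\in\mathbb{R}^n$: $$(1)\quad\left.\begin{array}{l}w_j=0\ \forall j\in I,\quad(\nabla^2f(\bar x)w)_j=0\ \forall j\in J,\\ w_j\le0,\ (\nabla^2f(\bar x)w)_j\le0,\ w_j(\nabla^2f(\bar x)w)_j=0\ \forall j\in K^+,\\ w_j\ge0,\ (\nabla^2f(\bar x)w)_j\ge0,\ w_j(\nabla^2f(\bar x)w)_j=0\ \forall j\in K^-\end{array}\right\}\Longrightarrow w=0.$$ Then $F$ satisfies the KL property at $\bar x$ with exponent $\frac12$, which is sharp if there is some $w\in\mathcal{V}(\bar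 x)$ with $\langle\nabla^2f(\bar x)w,w\rangle>0$. Moreover, $\mathrm{KL}(F,\bar x,\frac12)$ is equal to the square root of the optimal value of the smooth optimization problem $$(2)\quad\min_{(w,v)}\ \frac12\frac{\|v\|^2}{\langle v,w\rangle}\quad\text{subject to }(3),\ \|w\|^2=1,\ \langle v,w\rangle>0,$$ where (3) is the system $$(3)\quad\left\{\begin{array}{l}w_j=0\ \forall j\in I,\quad v_j-(\nabla^2f(\bar x)w)_j=0\ \forall j\in J,\\ w_j\le0,\ v_j-(\nabla^2f(\bar x)w)_j\ge0,\ w_j(v_j-(\nabla^2f(\bar x)w)_j)=0\ \forall j\in K^+,\\ w_j\ge0,\ v_j-(\nabla^2f(\bar x)w)_j\le0,\ w_j(v_j-(\nabla^2f(\bar x)w)_j)=0\ \forall j\in K^-.\end{array}\right.$$ In particular, when $0\in\operatorname{ri}\partial F(\bar x)$, one has $K^+\cup K^-=\emptyset$. In this case, condition (1) reduces to the nonsingularity of the submatrix $[\nabla^2f(\bar x)_{i,j}]_{i,j\in J}$, and solving (2) amounts to finding the smallest positive eigenvalue $\lambda_{\min}$ of $[\nabla^2f(\bar x)_{i,j}]_{i,j\in J}$ (that is, the optimal value of (2) is $\lambda_{\min}/2$, understood as $+\infty$ if there is no positive eigenvalue).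
   Context: $\|x\|_1=\sum_i|x_i|$; $\operatorname{ri}$ denotes relative interior. The optimal value of an infeasible minimization problem is $+\infty$. $d(v,A)=\inf_{a\in A}\|a-v\|$, with $d(v,\emptyset)=+\infty$. Subgradients. $v\in\widehat\partial F(x)$ if $F(y)\ge F(x)+\langle v,y-x\rangle+o(\|y-x\|)$. $v\in\partial F(x)$ (limiting) if there are $x_k\to x$, $v_k\to v$ with $F(x_k)\to F(x)$ and $v_k\in\widehat\partial F(x_k)$. Graphical derivative: $z\in D(\partial F)(\bar x\mid0)(w)$ iff $(w,z)\in T_{\operatorname{gph}\partial F}(\bar x,0)$, where $\operatorname{gph}\partial F=\{(x,v)\mid v\in\partial F(x)\}$ and $w\in T_A(x)$ iff there are $t_k\downarrow0$, $w_k\to w$ with $x+t_kw_k\in A$. KL property. $F$ satisfies the KL property at $\bar x$ with exponent $\theta\in[0,1)$ if there exist a modulus $\sigma>0$, $\epsilon>0$, $\nu\in(0,+\infty]$ such that $d(0,\partial F(x))\ge\frac{\sigma}{1-\theta}(F(x)-F(\bar x))^{\theta}$ whenever $\|x-\bar x\|\le\epsilon$ and $F(\bar x)<F(x)<F(\bar x)+\nu$. $\mathrm{KL}(F,\bar x,\theta)$ is the supremum of all such $\sigma$ ($\sup\emptyset:=0$); equivalently the liminf of $\frac{(1-\theta)d(0,\partial F(x))}{(F(x)-F(\bar x))^{\theta}}$ as $x\to\bar x$, $F(x)\to F(\bar x)$, $F(x)>F(\bar x)$ ($+\infty$ if there are no such sequences). An exponent $\theta\in(0,1)$ is sharp if $F$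 satisfies the KL property at $\bar x$ with exponent $\theta$ but not with any exponent $\theta'\in[0,\theta)$. *)

theory Defs
  imports "HOL-Analysis.Analysis" "HOL-Library.Landau_Symbols"
begin

definition gradient :: "('a::real_inner \<Rightarrow> real) \<Rightarrow> 'a \<Rightarrow> 'a" where
  "gradient f x = (THE g. GDERIV f x :> g)"

definition hessian :: "(real^'n \<Rightarrow> real) \<Rightarrow> real^'n \<Rightarrow> real^'n^'n" where
  "hessian f x = jacobian (gradient f) (at x)"

definition C2 :: "(real^'n \<Rightarrow> real) \<Rightarrow> bool" where
  "C2 f \<longleftrightarrow> (\<forall>x. f differentiable (at x)) \<and> (\<forall>x. gradient f differentiable (at x))
     \<and> continuous_on UNIV (hessian f)"


definition regular_subdiff :: "('a::real_inner \<Rightarrow> real) \<Rightarrow> 'a \<Rightarrow> 'a set" where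
  "regular_subdiff F x =
     {v. \<exists>r. r \<in> o[at x](\<lambda>y. norm (y - x)) \<and> (\<forall>y. F y \<ge> F x + v \<bullet> (y - x) + r y)}"

definition limiting_subdiff :: "('a::real_inner \<Rightarrow> real) \<Rightarrow> 'a \<Rightarrow> 'a set" where
  "limiting_subdiff F x =
     {v. \<exists>xs vs. xs \<longlonglongrightarrow> x \<and> vs \<longlonglongrightarrow> v \<and> (\<lambda>k. F (xs k)) \<longlonglongrightarrow> F x
           \<and> (\<forall>k. vs k \<in> regular_subdiff F (xs k))}"

definition tangent_cone :: "'a::real_normed_vector set \<Rightarrow> 'a \<Rightarrow> 'a set" where
  "tangent_cone A x =
     {w. \<exists>(t :: nat \<Rightarrow> real) ws. (\<forall>k. t k > 0) \<and> t \<longlonglongrightarrow> 0 \<and> ws \<longlonglongrightarrow> w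
           \<and> (\<forall>k. x + t k *\<^sub>R ws k \<in> A)}"

definition gph :: "('a \<Rightarrow> 'b set) \<Rightarrow> ('a \<times> 'b) set" where
  "gph S = {(x, v). v \<in> S x}"

definition graphical_deriv ::
  "('a::real_normed_vector \<Rightarrow> 'b::real_normed_vector set) \<Rightarrow> 'a \<Rightarrow> 'b \<Rightarrow> 'a \<Rightarrow> 'b set" where
  "graphical_deriv S x v w = {z. (w, z) \<in> tangent_cone (gph S) (x, v)}"

definition setvalued_inverse :: "('a \<Rightarrow> 'b set) \<Rightarrow> 'b \<Rightarrow> 'a set" where
  "setvalued_inverse S z = {w. z \<in> S w}"


text \<open>Extended-real valued, so that the distance to the empty set is \<open>\<infinity>\<close>
  (the library's \<open>infdist\<close> would give \<open>0\<close>).\<close>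

definition dist_set :: "'a::real_normed_vector \<Rightarrow> 'a set \<Rightarrow> ereal" where
  "dist_set v A = (INF a\<in>A. ereal (norm (a - v)))"

definition KL_with_modulus :: "('a::real_inner \<Rightarrow> real) \<Rightarrow> 'a \<Rightarrow> real \<Rightarrow> real \<Rightarrow> bool" where
  "KL_with_modulus F xb \<theta> \<sigma> \<longleftrightarrow> \<sigma> > 0 \<and>
     (\<exists>(\<epsilon>::real) > 0. \<exists>(\<nu>::ereal) > 0. \<forall>x.
        norm (x - xb) \<le> \<epsilon> \<and> F xb < F x \<and> ereal (F x) < ereal (F xb) + \<nu> \<longrightarrow>
        dist_set 0 (limiting_subdiff F x) \<ge> ereal (\<sigma> / (1 - \<theta>) * (F x - F xb) powr \<theta>))"

definition KL_property :: "('a::real_inner \<Rightarrow> real) \<Rightarrow> 'a \<Rightarrow> real \<Rightarrow> bool" where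
  "KL_property F xb \<theta> \<longleftrightarrow> 0 \<le> \<theta> \<and> \<theta> < 1 \<and> (\<exists>\<sigma>. KL_with_modulus F xb \<theta> \<sigma>)"

text \<open>All moduli are positive; inserting \<open>0\<close> only implements the convention
  \<open>sup {} = 0\<close> (in \<^typ>\<open>ereal\<close> one has \<open>Sup {} = -\<infinity>\<close>).\<close>

definition KL_modulus :: "('a::real_inner \<Rightarrow> real) \<Rightarrow> 'a \<Rightarrow> real \<Rightarrow> ereal" where
  "KL_modulus F xb \<theta> = Sup (insert 0 (ereal ` {\<sigma>. KL_with_modulus F xb \<theta> \<sigma>}))"

definition sharp_KL_exponent :: "('a::real_inner \<Rightarrow> real) \<Rightarrow> 'a \<Rightarrow> real \<Rightarrow> bool" where
  "sharp_KL_exponent F xb \<theta> \<longleftrightarrow> 0 < \<theta> \<and> \<theta> < 1 \<and> KL_property F xb \<theta>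
     \<and> (\<forall>\<theta>'. 0 \<le> \<theta>' \<and> \<theta>' < \<theta> \<longrightarrow> \<not> KL_property F xb \<theta>')"

definition ereal_sqrt :: "ereal \<Rightarrow> ereal" where
  "ereal_sqrt x = (case x of ereal r \<Rightarrow> ereal (sqrt r) | PInfty \<Rightarrow> \<infinity> | MInfty \<Rightarrow> -\<infinity>)"

text \<open>For \<open>J :: 'n set\<close> the principal submatrix of \<open>A\<close> with row and column indices in \<open>J\<close>
  is represented by the entries \<open>A $ i $ j\<close> with \<open>i, j \<in> J\<close>; matrix products and
  matrix-vector products are sums over \<open>J\<close>. For empty \<open>J\<close> it is the empty matrix, which is
  nonsingular and has no eigenvalues.\<close>

definition nonsingular_on :: "'n set \<Rightarrow> real^'n^'n \<Rightarrow> bool" where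
  "nonsingular_on J A \<longleftrightarrow> (\<exists>B :: 'n \<Rightarrow> 'n \<Rightarrow> real.
     \<forall>i\<in>J. \<forall>j\<in>J. (\<Sum>k\<in>J. A $ i $ k * B k j) = (if i = j then 1 else 0)
                 \<and> (\<Sum>k\<in>J. B i k * A $ k $ j) = (if i = j then 1 else 0))"

definition eigenvalue_on :: "'n set \<Rightarrow> real^'n^'n \<Rightarrow> real \<Rightarrow> bool" where
  "eigenvalue_on J A l \<longleftrightarrow> (\<exists>u :: 'n \<Rightarrow> real.
     (\<exists>i\<in>J. u i \<noteq> 0) \<and> (\<forall>i\<in>J. (\<Sum>j\<in>J. A $ i $ j * u j) = l * u i))"

definition min_pos_eigenvalue_on :: "'n set \<Rightarrow> real^'n^'n \<Rightarrow> ereal" where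
  "min_pos_eigenvalue_on J A =
     (let P = {l. eigenvalue_on J A l \<and> l > 0} in if P = {} then \<infinity> else ereal (Min P))"


definition norm1 :: "real^'n \<Rightarrow> real" where
  "norm1 x = (\<Sum>i\<in>UNIV. \<bar>x $ i\<bar>)"

definition idxI :: "(real^'n \<Rightarrow> real) \<Rightarrow> real \<Rightarrow> real^'n \<Rightarrow> 'n set" where
  "idxI f \<mu> xb = {i. xb $ i = 0 \<and> - \<mu> < gradient f xb $ i \<and> gradient f xb $ i < \<mu>}"

definition idxJ :: "(real^'n \<Rightarrow> real) \<Rightarrow> real \<Rightarrow> real^'n \<Rightarrow> 'n set" where
  "idxJ f \<mu> xb = {i. xb $ i \<noteq> 0 \<and> gradient f xb $ i + \<mu> * sgn (xb $ i) = 0}"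

definition idxKp :: "(real^'n \<Rightarrow> real) \<Rightarrow> real \<Rightarrow> real^'n \<Rightarrow> 'n set" where
  "idxKp f \<mu> xb = {i. xb $ i = 0 \<and> gradient f xb $ i = \<mu>}"

definition idxKm :: "(real^'n \<Rightarrow> real) \<Rightarrow> real \<Rightarrow> real^'n \<Rightarrow> 'n set" where
  "idxKm f \<mu> xb = {i. xb $ i = 0 \<and> gradient f xb $ i = - \<mu>}"

definition coneV :: "(real^'n \<Rightarrow> real) \<Rightarrow> real \<Rightarrow> real^'n \<Rightarrow> (real^'n) set" where
  "coneV f \<mu> xb = {w. (\<forall>j\<in>idxI f \<mu> xb. w $ j = 0)
     \<and> (\<forall>j\<in>idxKp f \<mu> xb. w $ j \<le> 0) \<and> (\<forall>j\<in>idxKm f \<mu> xb. w $ j \<ge> 0)}"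

definition isolation_cond :: "(real^'n \<Rightarrow> real) \<Rightarrow> real \<Rightarrow> real^'n \<Rightarrow> bool" where
  "isolation_cond f \<mu> xb \<longleftrightarrow> (\<forall>w. let Hw = hessian f xb *v w in
     (\<forall>j\<in>idxI f \<mu> xb. w $ j = 0) \<and> (\<forall>j\<in>idxJ f \<mu> xb. Hw $ j = 0)
     \<and> (\<forall>j\<in>idxKp f \<mu> xb. w $ j \<le> 0 \<and> Hw $ j \<le> 0 \<and> w $ j * Hw $ j = 0)
     \<and> (\<forall>j\<in>idxKm f \<mu> xb. w $ j \<ge> 0 \<and> Hw $ j \<ge> 0 \<and> w $ j * Hw $ j = 0)
     \<longrightarrow> w = 0)"

definition KL_system :: "(real^'n \<Rightarrow> real) \<Rightarrow> real \<Rightarrow> real^'n \<Rightarrow> real^'n \<Rightarrow> real^'n \<Rightarrow> bool" where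
  "KL_system f \<mu> xb w v \<longleftrightarrow> (let Hw = hessian f xb *v w in
     (\<forall>j\<in>idxI f \<mu> xb. w $ j = 0) \<and> (\<forall>j\<in>idxJ f \<mu> xb. v $ j - Hw $ j = 0)
     \<and> (\<forall>j\<in>idxKp f \<mu> xb. w $ j \<le> 0 \<and> v $ j - Hw $ j \<ge> 0 \<and> w $ j * (v $ j - Hw $ j) = 0)
     \<and> (\<forall>j\<in>idxKm f \<mu> xb. w $ j \<ge> 0 \<and> v $ j - Hw $ j \<le> 0 \<and> w $ j * (v $ j - Hw $ j) = 0))"

text \<open>An infimum over the empty set is \<open>\<infinity>\<close> in \<^typ>\<open>ereal\<close>, as required for an infeasible problem.\<close>

definition KL_optval :: "(real^'n \<Rightarrow> real) \<Rightarrow> real \<Rightarrow> real^'n \<Rightarrow> ereal" where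
  "KL_optval f \<mu> xb =
     (INF (w, v) \<in> {(w, v). KL_system f \<mu> xb w v \<and> (norm w)\<^sup>2 = 1 \<and> v \<bullet> w > 0}.
        ereal (1 / 2 * ((norm v)\<^sup>2 / (v \<bullet> w))))"

end

theory Submission
  imports Defs
begin

text \<open>
  The subdifferential of \<open>F\<close> at \<open>x\<close> is \<open>\<nabla>f x\<close> plus the subdifferential of \<open>\<mu> \<parallel>\<cdot>\<parallel>\<^sub>1\<close>, and the graph of
  the latter is a product of scalar broken lines. Near a point, a broken line coincides with its
  tangent cone, and the smooth part contributes the Hessian \<open>H\<close> at \<open>xb\<close>; hence \<open>z\<close> lies in the
  graphical derivative at \<open>w\<close> exactly when \<open>(w, z)\<close> solves the complementarity system
  \<open>KL_system\<close> (\<open>graphical_deriv_subdiff_iff\<close>). The case \<open>z = 0\<close> is the isolation condition.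

  The second ingredient is an expansion of the values. Near \<open>xb\<close> the norm is affine along the
  segment to \<open>xb\<close> with slope any subgradient at the other endpoint. So if \<open>w\<^sub>k \<rightarrow> w\<close>,
  \<open>v\<^sub>k \<in> \<partial>F (xb + t\<^sub>k w\<^sub>k)\<close> and \<open>v\<^sub>k / t\<^sub>k \<rightarrow> z\<close>, then \<open>F (xb + t\<^sub>k w\<^sub>k) - F xb\<close> equals
  \<open>t\<^sub>k\<^sup>2 (z \<bullet> w - H w \<bullet> w / 2)\<close> up to \<open>o(t\<^sub>k\<^sup>2)\<close>, and complementarity gives \<open>z \<bullet> w = H w \<bullet> w\<close>
  (\<open>value_quotient_limit\<close>). The squared quotient that defines the modulus,
  \<open>\<parallel>v\<^sub>k\<parallel>\<^sup>2 / (4 (F (xb + t\<^sub>k w\<^sub>k) - F xb))\<close>, therefore tends to \<open>\<parallel>z\<parallel>\<^sup>2 / (2 (z \<bullet> w))\<close>, the objective of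
  the optimisation problem.

  This yields both inequalities for the modulus. Every feasible pair \<open>(w, z)\<close> is attained along a
  straight line (\<open>KL_with_modulus_le\<close>), and the same lines exclude smaller exponents
  (\<open>not_KL_property_below_half\<close>). Conversely, if the inequality fails with moduli \<open>\<sigma>\<^sub>k \<rightarrow> \<sigma>\<close>
  at points tending to \<open>xb\<close>, the expansion bounds \<open>v\<^sub>k / t\<^sub>k\<close>, and a limit is a solution with
  \<open>\<parallel>w\<parallel> = 1\<close> and \<open>\<parallel>z\<parallel>\<^sup>2 \<le> 2 \<sigma>\<^sup>2 (z \<bullet> w)\<close> (\<open>slope_bound_limit\<close>). The isolation condition makes
  \<open>z \<noteq> 0\<close>, hence \<open>z \<bullet> w > 0\<close>: this excludes \<open>\<sigma> = 0\<close>, which is the exponent one half, and for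
  \<open>\<sigma> > 0\<close> it produces a feasible pair with objective at most \<open>\<sigma>\<^sup>2\<close>.

  If \<open>0\<close> is a relative interior point, there are no corners, and the problem becomes the
  minimisation of \<open>\<parallel>A w\<parallel>\<^sup>2 / (2 (A w \<bullet> w))\<close> for the symmetric principal submatrix \<open>A\<close> of the Hessian.
  In an eigenbasis \<open>l (A w \<bullet> w) \<le> \<parallel>A w\<parallel>\<^sup>2\<close> is clear if \<open>A\<close> has no eigenvalue strictly between \<open>0\<close> and
  \<open>l\<close>; here it is derived by a variational argument (\<open>selfadjoint_no_eigenvalue_below\<close>).
\<close>

section \<open>Calculus along sequences\<close>

text \<open>Directions are bounded rather than convergent because below they come from intermediate points
  of the mean value theorem.\<close>

lemma has_derivative_along_sequence:
  fixes \<phi> :: "'a::real_normed_vector \<Rightarrow> 'b::real_normed_vector"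
  assumes D: "(\<phi> has_derivative D) (at x)"
    and t: "\<And>k. t k > 0" "t \<longlonglongrightarrow> 0" and w: "Bseq w"
  shows "(\<lambda>k. (\<phi> (x + t k *\<^sub>R w k) - \<phi> x) /\<^sub>R t k - D (w k)) \<longlonglongrightarrow> 0"
proof -
  define N where "N h = norm (\<phi> (x + h) - \<phi> x - D h) / norm h" for h
  from w obtain K where K: "K > 0" "\<And>k. norm (w k) \<le> K" by (auto simp: Bseq_def)
  have lin: "bounded_linear D" and "N \<midarrow>0\<rightarrow> 0"
    using D by (simp_all add: has_derivative_at N_def[abs_def])
  moreover have "N 0 = 0" by (simp add: N_def)
  ultimately have "isCont N 0" by (simp add: isCont_def)
  moreover have "(\<lambda>k. t k *\<^sub>R w k) \<longlonglongrightarrow> 0"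
  proof (rule Lim_null_comparison)
    show "\<forall>\<^sub>F k in sequentially. norm (t k *\<^sub>R w k) \<le> t k * K"
      using K t(1) by (auto intro!: always_eventually mult_left_mono simp: less_imp_le)
    show "(\<lambda>k. t k * K) \<longlonglongrightarrow> 0" using tendsto_mult_left_zero[OF t(2)] by simp
  qed
  ultimately have "(\<lambda>k. N (t k *\<^sub>R w k)) \<longlonglongrightarrow> N 0" by (rule isCont_tendsto_compose)
  then have lim: "(\<lambda>k. N (t k *\<^sub>R w k) * K) \<longlonglongrightarrow> 0"
    using \<open>N 0 = 0\<close> tendsto_mult_left_zero by fastforce
  interpret D: bounded_linear D by (rule lin)
  have "norm ((\<phi> (x + t k *\<^sub>R w k) - \<phi> x) /\<^sub>R t k - D (w k)) \<le> N (t k *\<^sub>R w k) * K" for k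
  proof -
    have "(\<phi> (x + t k *\<^sub>R w k) - \<phi> x) /\<^sub>R t k - D (w k)
        = (\<phi> (x + t k *\<^sub>R w k) - \<phi> x - D (t k *\<^sub>R w k)) /\<^sub>R t k"
      using t(1)[of k] by (simp add: D.scaleR scaleR_diff_right)
    then have "norm ((\<phi> (x + t k *\<^sub>R w k) - \<phi> x) /\<^sub>R t k - D (w k)) = N (t k *\<^sub>R w k) * norm (w k)"
      using t(1)[of k] by (cases "w k = 0") (simp_all add: N_def D.zero divide_simps)
    also have "\<dots> \<le> N (t k *\<^sub>R w k) * K"
      using K by (intro mult_left_mono) (auto simp: N_def)
    finally show ?thesis .
  qed
  then show ?thesis by (intro Lim_null_comparison[OF _ lim]) simp
qed

lemma directional_derivative_along_sequence:
  fixes \<phi> :: "'a::real_normed_vector \<Rightarrow> 'b::real_normed_vector"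
  assumes D: "(\<phi> has_derivative D) (at x)"
    and t: "\<And>k. t k > 0" "t \<longlonglongrightarrow> 0" and w: "w \<longlonglongrightarrow> w0"
  shows "(\<lambda>k. (\<phi> (x + t k *\<^sub>R w k) - \<phi> x) /\<^sub>R t k) \<longlonglongrightarrow> D w0"
proof -
  have "Bseq w" using w by (rule convergent_imp_Bseq[OF convergentI])
  note has_derivative_along_sequence[OF D t this]
  moreover have "(\<lambda>k. D (w k)) \<longlonglongrightarrow> D w0"
    using w by (rule bounded_linear.tendsto[OF has_derivative_bounded_linear[OF D]])
  ultimately have "(\<lambda>k. ((\<phi> (x + t k *\<^sub>R w k) - \<phi> x) /\<^sub>R t k - D (w k)) + D (w k)) \<longlonglongrightarrow> 0 + D w0"
    by (rule tendsto_add)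
  then show ?thesis by simp
qed

lemma has_derivative_gradient:
  fixes f :: "real^'n \<Rightarrow> real"
  assumes "f differentiable (at x)"
  shows "(f has_derivative (\<lambda>h. h \<bullet> gradient f x)) (at x)"
proof -
  from assms obtain D where D: "(f has_derivative D) (at x)" by (auto simp: differentiable_def)
  have "D h = h \<bullet> adjoint D 1" for h
    using adjoint_works[OF has_derivative_linear[OF D], of h 1] by simp
  with D have G: "GDERIV f x :> adjoint D 1"
    unfolding gderiv_def by (metis ext)
  have "d = adjoint D 1" if "GDERIV f x :> d" for d
  proof -
    have "(\<lambda>h. h \<bullet> d) = (\<lambda>h. h \<bullet> adjoint D 1)"
      using that G unfolding gderiv_def by (rule has_derivative_unique)
    then show ?thesis by (metis vector_eq_ldot)
  qed
  then have "GDERIV f x :> gradient f x"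
    unfolding gradient_def using G by (metis theI)
  then show ?thesis by (simp add: gderiv_def)
qed

lemma C2_has_derivatives:
  fixes f :: "real^'n \<Rightarrow> real"
  assumes "C2 f"
  shows C2_has_gradient: "(f has_derivative (\<lambda>h. h \<bullet> gradient f x)) (at x)"
    and C2_has_hessian: "(gradient f has_derivative (\<lambda>h. hessian f x *v h)) (at x)"
  using assms jacobian_works[of "gradient f" "at x"]
  by (auto simp: C2_def hessian_def intro: has_derivative_gradient)

lemma C2_line_derivative:
  fixes f :: "real^'n \<Rightarrow> real"
  assumes "C2 f"
  shows "((\<lambda>s. f (a + s *\<^sub>R h)) has_real_derivative (gradient f (a + s *\<^sub>R h) \<bullet> h)) (at s)"
proof -
  have "((\<lambda>s. f (a + s *\<^sub>R h)) has_derivative (\<lambda>r. (r *\<^sub>R h) \<bullet> gradient f (a + s *\<^sub>R h))) (at s)"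
    by (rule has_derivative_compose[OF _ C2_has_gradient[OF assms], of "\<lambda>s. a + s *\<^sub>R h" "\<lambda>r. r *\<^sub>R h" s UNIV])
      (auto intro!: derivative_eq_intros)
  then show ?thesis
    by (rule has_derivative_imp_has_field_derivative) (simp add: inner_commute)
qed

text \<open>Second-order Taylor expansion: the mean value theorem turns the remainder into a first-order
  remainder of the gradient at an intermediate point \<open>x + c \<cdot> t \<cdot> w\<close>, to which
  the expansion of the gradient applies with step \<open>c \<cdot> t\<close>.\<close>

lemma C2_taylor_along_sequence:
  fixes f :: "real^'n \<Rightarrow> real"
  assumes f: "C2 f" and t: "\<And>k. t k > 0" "t \<longlonglongrightarrow> 0" and w: "w \<longlonglongrightarrow> w0"
  shows "(\<lambda>k. (f (x + t k *\<^sub>R w k) - f x - t k * (gradient f x \<bullet> w k)) / (t k)\<^sup>2)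
    \<longlonglongrightarrow> ((hessian f x *v w0) \<bullet> w0) / 2"
proof -
  let ?g = "gradient f" and ?H = "hessian f x"
  have "\<exists>c>0. c < 1 \<and> f (x + t k *\<^sub>R w k) - f x - t k * (?g x \<bullet> w k) - (t k)\<^sup>2 / 2 * ((?H *v w k) \<bullet> w k)
      = t k * ((?g (x + (c * t k) *\<^sub>R w k) - ?g x - (c * t k) *\<^sub>R (?H *v w k)) \<bullet> w k)" for k
  proof -
    define \<psi> where "\<psi> s = f (x + s *\<^sub>R (t k *\<^sub>R w k)) - s * (t k * (?g x \<bullet> w k))
      - s\<^sup>2 * ((t k)\<^sup>2 / 2 * ((?H *v w k) \<bullet> w k))" for s
    have "\<exists>c>0. c < 1 \<and> \<psi> 1 - \<psi> 0 = (1 - 0) * (?g (x + c *\<^sub>R (t k *\<^sub>R w k)) \<bullet> (t k *\<^sub>R w k)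
        - t k * (?g x \<bullet> w k) - 2 * c * ((t k)\<^sup>2 / 2 * ((?H *v w k) \<bullet> w k)))"
      unfolding \<psi>_def
      by (rule MVT2, simp) (rule derivative_eq_intros C2_line_derivative[OF f] refl | simp)+
    then show ?thesis
      by (auto simp: \<psi>_def inner_diff_left algebra_simps power2_eq_square)
  qed
  then obtain c where c: "\<And>k. c k > 0" "\<And>k. c k < 1"
    and eq: "\<And>k. f (x + t k *\<^sub>R w k) - f x - t k * (?g x \<bullet> w k) - (t k)\<^sup>2 / 2 * ((?H *v w k) \<bullet> w k)
      = t k * ((?g (x + (c k * t k) *\<^sub>R w k) - ?g x - (c k * t k) *\<^sub>R (?H *v w k)) \<bullet> w k)"
    by metis
  define r where "r k = (?g (x + (c k * t k) *\<^sub>R w k) - ?g x) /\<^sub>R (c k * t k) - ?H *v w k" for k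
  have "(\<lambda>k. c k * t k) \<longlonglongrightarrow> 0"
  proof (rule Lim_null_comparison[OF _ t(2)])
    show "\<forall>\<^sub>F k in sequentially. norm (c k * t k) \<le> t k"
      using c t(1) by (auto intro!: always_eventually simp: abs_mult less_imp_le)
  qed
  moreover have "Bseq w" using w by (rule convergent_imp_Bseq[OF convergentI])
  ultimately have "r \<longlonglongrightarrow> 0"
    unfolding r_def[abs_def] using c t
    by (intro has_derivative_along_sequence C2_has_hessian[OF f]) auto
  then have "(\<lambda>k. r k \<bullet> w k) \<longlonglongrightarrow> 0 \<bullet> w0" using w by (intro tendsto_intros)
  then have "(\<lambda>k. \<bar>r k \<bullet> w k\<bar>) \<longlonglongrightarrow> 0" by (simp add: tendsto_rabs_zero)
  then have "(\<lambda>k. c k * (r k \<bullet> w k)) \<longlonglongrightarrow> 0"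
  proof (rule Lim_null_comparison[rotated])
    have "c k * \<bar>r k \<bullet> w k\<bar> \<le> 1 * \<bar>r k \<bullet> w k\<bar>" for k
      using c[of k] by (intro mult_right_mono) auto
    then show "\<forall>\<^sub>F k in sequentially. norm (c k * (r k \<bullet> w k)) \<le> \<bar>r k \<bullet> w k\<bar>"
      using c by (auto intro!: always_eventually simp: abs_mult less_imp_le)
  qed
  moreover have "(\<lambda>k. ((?H *v w k) \<bullet> w k) / 2) \<longlonglongrightarrow> ((?H *v w0) \<bullet> w0) / 2"
    using w by (intro tendsto_intros bounded_linear.tendsto[OF matrix_vector_mul_bounded_linear]) auto
  ultimately have "(\<lambda>k. c k * (r k \<bullet> w k) + ((?H *v w k) \<bullet> w k) / 2) \<longlonglongrightarrow> 0 + ((?H *v w0) \<bullet> w0) / 2"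
    by (intro tendsto_add)
  moreover have "(f (x + t k *\<^sub>R w k) - f x - t k * (?g x \<bullet> w k)) / (t k)\<^sup>2
      = c k * (r k \<bullet> w k) + ((?H *v w k) \<bullet> w k) / 2" for k
  proof -
    have "(?g (x + (c k * t k) *\<^sub>R w k) - ?g x - (c k * t k) *\<^sub>R (?H *v w k)) = (c k * t k) *\<^sub>R r k"
    proof -
      have "c k * t k \<noteq> 0" using c(1)[of k] t(1)[of k] by simp
      then show ?thesis by (simp add: r_def scaleR_diff_right del: mult_eq_0_iff inverse_mult_distrib)
    qed
    then have "f (x + t k *\<^sub>R w k) - f x - t k * (?g x \<bullet> w k)
        = (t k)\<^sup>2 * (c k * (r k \<bullet> w k) + ((?H *v w k) \<bullet> w k) / 2)"
      using eq[of k] by (simp add: algebra_simps power2_eq_square)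
    then show ?thesis using t(1)[of k] by simp
  qed
  ultimately show ?thesis by simp
qed

text \<open>The Hessian is symmetric: the mixed second difference
  \<open>f (x + t h + t k) - f (x + t h) - f (x + t k) + f x\<close> is symmetric in \<open>h\<close> and \<open>k\<close>, and the mean
  value theorem in the direction \<open>k\<close> identifies its second-order coefficient as \<open>H h \<bullet> k\<close>.\<close>

lemma mixed_difference_limit:
  fixes f :: "real^'n \<Rightarrow> real"
  assumes f: "C2 f" and t: "\<And>n. t n > 0" "t \<longlonglongrightarrow> 0"
  shows "(\<lambda>n. (f (x + t n *\<^sub>R h + t n *\<^sub>R k) - f (x + t n *\<^sub>R h) - f (x + t n *\<^sub>R k) + f x) / (t n)\<^sup>2)
    \<longlonglongrightarrow> (hessian f x *v h) \<bullet> k"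
proof -
  let ?g = "gradient f" and ?H = "hessian f x"
  have "\<exists>c>0. c < 1 \<and> f (x + t n *\<^sub>R h + t n *\<^sub>R k) - f (x + t n *\<^sub>R h) - f (x + t n *\<^sub>R k) + f x
      = t n * ((?g (x + t n *\<^sub>R (h + c *\<^sub>R k)) - ?g (x + t n *\<^sub>R (c *\<^sub>R k))) \<bullet> k)" for n
  proof -
    define \<psi> where "\<psi> s = f ((x + t n *\<^sub>R h) + s *\<^sub>R (t n *\<^sub>R k)) - f (x + s *\<^sub>R (t n *\<^sub>R k))" for s
    have "\<exists>c>0. c < 1 \<and> \<psi> 1 - \<psi> 0 = (1 - 0) * (?g ((x + t n *\<^sub>R h) + c *\<^sub>R (t n *\<^sub>R k)) \<bullet> (t n *\<^sub>R k)
        - ?g (x + c *\<^sub>R (t n *\<^sub>R k)) \<bullet> (t n *\<^sub>R k))"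
      unfolding \<psi>_def by (rule MVT2, simp) (rule DERIV_diff C2_line_derivative[OF f])+
    then show ?thesis
      by (auto simp: \<psi>_def algebra_simps)
  qed
  then obtain c where c: "\<And>n. c n > 0" "\<And>n. c n < 1"
    and eq: "\<And>n. f (x + t n *\<^sub>R h + t n *\<^sub>R k) - f (x + t n *\<^sub>R h) - f (x + t n *\<^sub>R k) + f x
      = t n * ((?g (x + t n *\<^sub>R (h + c n *\<^sub>R k)) - ?g (x + t n *\<^sub>R (c n *\<^sub>R k))) \<bullet> k)"
    by metis
  have ck: "norm (c n *\<^sub>R k) \<le> norm k" for n
    using mult_right_mono[of "c n" 1 "norm k"] c[of n] by (simp add: less_imp_le)
  have B: "Bseq (\<lambda>n. h + c n *\<^sub>R k)" "Bseq (\<lambda>n. c n *\<^sub>R k)"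
  proof -
    show "Bseq (\<lambda>n. h + c n *\<^sub>R k)"
      by (rule BseqI'[of _ "norm h + norm k"]) (metis ck norm_triangle_le add_left_mono)
    show "Bseq (\<lambda>n. c n *\<^sub>R k)" by (rule BseqI'[OF ck])
  qed
  define r where "r n = (?g (x + t n *\<^sub>R (h + c n *\<^sub>R k)) - ?g x) /\<^sub>R t n - ?H *v (h + c n *\<^sub>R k)" for n
  define r' where "r' n = (?g (x + t n *\<^sub>R (c n *\<^sub>R k)) - ?g x) /\<^sub>R t n - ?H *v (c n *\<^sub>R k)" for n
  have "r \<longlonglongrightarrow> 0" "r' \<longlonglongrightarrow> 0"
    unfolding r_def[abs_def] r'_def[abs_def]
    by (intro has_derivative_along_sequence[OF C2_has_hessian[OF f] t] B)+
  then have "(\<lambda>n. (r n - r' n + ?H *v h) \<bullet> k) \<longlonglongrightarrow> (0 - 0 + ?H *v h) \<bullet> k"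
    by (intro tendsto_intros)
  moreover have "(f (x + t n *\<^sub>R h + t n *\<^sub>R k) - f (x + t n *\<^sub>R h) - f (x + t n *\<^sub>R k) + f x) / (t n)\<^sup>2
      = (r n - r' n + ?H *v h) \<bullet> k" for n
  proof -
    have "?g (x + t n *\<^sub>R (h + c n *\<^sub>R k)) - ?g (x + t n *\<^sub>R (c n *\<^sub>R k))
       = t n *\<^sub>R (r n - r' n + ?H *v h)"
      using t(1)[of n]
      by (simp add: r_def r'_def matrix_vector_right_distrib scaleR_diff_right scaleR_add_right)
    then show ?thesis
      unfolding eq using t(1)[of n] by (simp add: power2_eq_square)
  qed
  ultimately show ?thesis by simp
qed

lemma hessian_symmetric:
  fixes f :: "real^'n \<Rightarrow> real"
  assumes "C2 f"
  shows "(hessian f x *v h) \<bullet> k = (hessian f x *v k) \<bullet> h"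
proof -
  have t: "\<And>n. 0 < 1 / real (Suc n)" "(\<lambda>n. 1 / real (Suc n)) \<longlonglongrightarrow> 0"
    by (simp, rule LIMSEQ_Suc[OF lim_1_over_n])
  show ?thesis
    using mixed_difference_limit[OF assms t, of x h k]
      mixed_difference_limit[OF assms t, of x k h]
    by (intro LIMSEQ_unique) (simp_all add: algebra_simps)
qed

section \<open>The subdifferential of the composite function\<close>

text \<open>The subdifferential of \<open>\<mu> \<parallel>\<cdot>\<parallel>\<^sub>1\<close>, written with closed conditions: where \<open>x\<^sub>i \<noteq> 0\<close> they force
  \<open>s\<^sub>i = \<mu> sgn x\<^sub>i\<close>, elsewhere only \<open>\<bar>s\<^sub>i\<bar> \<le> \<mu>\<close> remains. In this form, stability under limits is
  immediate.\<close>

definition abs_subgradient :: "real \<Rightarrow> real \<Rightarrow> real \<Rightarrow> bool" where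
  "abs_subgradient \<mu> a s \<longleftrightarrow> \<bar>s\<bar> \<le> \<mu> \<and> s * a = \<mu> * \<bar>a\<bar>"

definition l1_subgradients :: "real \<Rightarrow> real^'n \<Rightarrow> (real^'n) set" where
  "l1_subgradients \<mu> x = {s. \<forall>i. abs_subgradient \<mu> (x $ i) (s $ i)}"

lemma abs_subgradient_pos: "abs_subgradient \<mu> a s \<Longrightarrow> a > 0 \<Longrightarrow> s = \<mu>"
  and abs_subgradient_neg: "abs_subgradient \<mu> a s \<Longrightarrow> a < 0 \<Longrightarrow> s = - \<mu>"
proof -
  show "abs_subgradient \<mu> a s \<Longrightarrow> a > 0 \<Longrightarrow> s = \<mu>" by (simp add: abs_subgradient_def)
  assume "abs_subgradient \<mu> a s" "a < 0"
  then have "(s + \<mu>) * a = 0" by (simp add: abs_subgradient_def algebra_simps)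
  with \<open>a < 0\<close> show "s = - \<mu>" by simp
qed

lemma abs_subgradient_minus: "abs_subgradient \<mu> a s \<Longrightarrow> abs_subgradient \<mu> (- a) (- s)"
  unfolding abs_subgradient_def by (simp only: abs_minus_cancel minus_mult_minus)

lemma inner_l1_subgradient:
  assumes "s \<in> l1_subgradients \<mu> x"
  shows "s \<bullet> x = \<mu> * norm1 x"
  using assms by (simp add: l1_subgradients_def abs_subgradient_def inner_vec_def norm1_def sum_distrib_left)

lemma inner_le_norm1:
  assumes "\<And>i. \<bar>s $ i\<bar> \<le> \<mu>"
  shows "s \<bullet> y \<le> \<mu> * norm1 y"
proof -
  have "s $ i * y $ i \<le> \<mu> * \<bar>y $ i\<bar>" for i
  proof -
    have "s $ i * y $ i \<le> \<bar>s $ i\<bar> * \<bar>y $ i\<bar>" by (metis abs_ge_self abs_mult)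
    also have "\<dots> \<le> \<mu> * \<bar>y $ i\<bar>" using assms by (intro mult_right_mono) auto
    finally show ?thesis .
  qed
  then show ?thesis by (simp add: inner_vec_def norm1_def sum_distrib_left sum_mono)
qed

lemma norm1_add_axis: "norm1 (x + axis i \<tau>) - norm1 x = \<bar>x $ i + \<tau>\<bar> - \<bar>x $ i\<bar>"
proof -
  have "norm1 (x + axis i \<tau>) - norm1 x = (\<Sum>j\<in>UNIV. \<bar>x $ j + axis i \<tau> $ j\<bar> - \<bar>x $ j\<bar>)"
    by (simp add: norm1_def sum_subtractf)
  also have "\<dots> = (\<Sum>j\<in>UNIV. if j = i then \<bar>x $ i + \<tau>\<bar> - \<bar>x $ i\<bar> else 0)"
    by (intro sum.cong) (auto simp: axis_def)
  finally show ?thesis by simp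
qed

text \<open>An affine minorant of \<open>\<mu> \<bar>\<cdot>\<bar>\<close> up to a first-order error is a subgradient: moving \<open>a\<close> in the
  direction of the sign of \<open>s\<close> gives \<open>\<bar>s\<bar> \<le> \<mu>\<close>, and moving it towards \<open>0\<close> gives the equality.\<close>

lemma abs_subgradientI:
  assumes "\<mu> > 0"
    and H: "\<And>e. e > 0 \<Longrightarrow> \<exists>\<delta>>0. \<forall>\<tau>. 0 < \<bar>\<tau>\<bar> \<and> \<bar>\<tau>\<bar> < \<delta> \<longrightarrow> \<mu> * (\<bar>a + \<tau>\<bar> - \<bar>a\<bar>) \<ge> s * \<tau> - e * \<bar>\<tau>\<bar>"
  shows "abs_subgradient \<mu> a s"
proof -
  have le: "\<bar>s\<bar> \<le> \<mu>"
  proof (rule field_le_epsilon)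
    fix e :: real assume "e > 0"
    from H[OF this] obtain \<delta> where \<delta>: "\<delta> > 0"
      "\<And>\<tau>. 0 < \<bar>\<tau>\<bar> \<Longrightarrow> \<bar>\<tau>\<bar> < \<delta> \<Longrightarrow> \<mu> * (\<bar>a + \<tau>\<bar> - \<bar>a\<bar>) \<ge> s * \<tau> - e * \<bar>\<tau>\<bar>" by blast
    define \<tau> where "\<tau> = (if s \<ge> 0 then \<delta> / 2 else - \<delta> / 2)"
    have \<tau>: "s * \<tau> = \<bar>s\<bar> * (\<delta> / 2)" "\<bar>\<tau>\<bar> = \<delta> / 2" using \<delta>(1) by (auto simp: \<tau>_def)
    have "s * \<tau> - e * \<bar>\<tau>\<bar> \<le> \<mu> * (\<bar>a + \<tau>\<bar> - \<bar>a\<bar>)" using \<delta> \<tau> by (intro \<delta>(2)) auto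
    also have "\<dots> \<le> \<mu> * \<bar>\<tau>\<bar>" using \<open>\<mu> > 0\<close> by (intro mult_left_mono) auto
    finally have "(\<bar>s\<bar> - e) * (\<delta> / 2) \<le> \<mu> * (\<delta> / 2)" unfolding \<tau> by (simp add: algebra_simps)
    then have "\<bar>s\<bar> - e \<le> \<mu>" using \<delta>(1) mult_le_cancel_right_pos[of "\<delta> / 2"] by auto
    then show "\<bar>s\<bar> \<le> \<mu> + e" by simp
  qed
  have ge: "\<mu> \<le> s * sgn a" if "a \<noteq> 0"
  proof (rule field_le_epsilon)
    fix e :: real assume "e > 0"
    from H[OF this] obtain \<delta> where \<delta>: "\<delta> > 0"
      "\<And>\<tau>. 0 < \<bar>\<tau>\<bar> \<Longrightarrow> \<bar>\<tau>\<bar> < \<delta> \<Longrightarrow> \<mu> * (\<bar>a + \<tau>\<bar> - \<bar>a\<bar>) \<ge> s * \<tau> - e * \<bar>\<tau>\<bar>" by blast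
    define \<eta> where "\<eta> = min (\<delta> / 2) (\<bar>a\<bar> / 2)"
    have \<eta>: "\<eta> > 0" "\<eta> < \<delta>" "\<eta> < \<bar>a\<bar>" using \<delta>(1) that by (auto simp: \<eta>_def min_def)
    define \<tau> where "\<tau> = - (sgn a * \<eta>)"
    have abs: "\<bar>\<tau>\<bar> = \<eta>" using \<eta> that by (simp add: \<tau>_def abs_mult abs_sgn_eq)
    have "\<bar>a + \<tau>\<bar> - \<bar>a\<bar> = - \<eta>" using \<eta> that by (auto simp: \<tau>_def sgn_if)
    moreover have "s * \<tau> - e * \<bar>\<tau>\<bar> \<le> \<mu> * (\<bar>a + \<tau>\<bar> - \<bar>a\<bar>)"
      using \<eta> abs by (intro \<delta>(2)) auto
    ultimately have "s * \<tau> - e * \<eta> \<le> \<mu> * (- \<eta>)" using abs by simp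
    then have "\<mu> * \<eta> \<le> (s * sgn a + e) * \<eta>"
      by (simp add: \<tau>_def algebra_simps)
    then show "\<mu> \<le> s * sgn a + e" using \<eta>(1) by simp
  qed
  have "s * a = \<mu> * \<bar>a\<bar>"
  proof (cases "a = 0")
    case False
    have "s * sgn a \<le> \<bar>s\<bar>" using False by (auto simp: sgn_if)
    with ge[OF False] le have "s * sgn a = \<mu>" by simp
    then have "\<mu> * \<bar>a\<bar> = s * (sgn a * \<bar>a\<bar>)" by simp
    then show ?thesis by (simp add: sgn_mult_abs)
  qed simp
  with le show ?thesis by (simp add: abs_subgradient_def)
qed

locale l1_composite =
  fixes f F :: "real^'n \<Rightarrow> real" and \<mu> :: real
  assumes C2: "C2 f" and mu_pos: "\<mu> > 0" and F_eq: "\<And>x. F x = f x + \<mu> * norm1 x"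
begin

abbreviation "g \<equiv> gradient f"

lemma tendsto_gradient:
  assumes "(xs \<longlongrightarrow> x) \<F>"
  shows "((\<lambda>k. g (xs k)) \<longlongrightarrow> g x) \<F>"
  using has_derivative_continuous[OF C2_has_hessian[OF C2]] assms
  by (rule isCont_tendsto_compose)

text \<open>The first-order Taylor remainder of \<open>f\<close> serves as the error term of a regular subgradient; for
  the converse it suffices to test along the coordinate axes, since the norm is separable.\<close>

lemma regular_subdiff_eq: "regular_subdiff F x = {v. v - g x \<in> l1_subgradients \<mu> x}"
proof (intro equalityI subsetI CollectI)
  fix v assume "v \<in> {v. v - g x \<in> l1_subgradients \<mu> x}"
  then have s: "v - g x \<in> l1_subgradients \<mu> x" by simp
  define r where "r y = f y - f x - (y - x) \<bullet> g x" for y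
  have "r \<in> o[at x](\<lambda>y. norm (y - x))"
  proof (rule landau_o.smallI)
    fix c :: real assume "c > 0"
    then obtain d where "d > 0" "\<forall>y. norm (y - x) < d \<longrightarrow> norm (r y) \<le> c * norm (y - x)"
      using C2_has_gradient[OF C2, of x] unfolding has_derivative_at_alt r_def by blast
    then show "\<forall>\<^sub>F y in at x. norm (r y) \<le> c * norm (norm (y - x))"
      unfolding eventually_at by (auto simp: dist_norm)
  qed
  moreover have "F y \<ge> F x + v \<bullet> (y - x) + r y" for y
    using inner_l1_subgradient[OF s] inner_le_norm1[of "v - g x" \<mu> y] s
    by (simp add: F_eq r_def inner_diff_left inner_diff_right inner_commute
        l1_subgradients_def abs_subgradient_def algebra_simps)
  ultimately show "v \<in> regular_subdiff F x" by (auto simp: regular_subdiff_def)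
next
  fix v assume "v \<in> regular_subdiff F x"
  then obtain r where r: "r \<in> o[at x](\<lambda>y. norm (y - x))"
    and sub: "\<And>y. F y \<ge> F x + v \<bullet> (y - x) + r y" by (auto simp: regular_subdiff_def)
  have "abs_subgradient \<mu> (x $ i) ((v - g x) $ i)" for i
  proof (rule abs_subgradientI[OF mu_pos])
    fix e :: real assume e: "e > 0"
    obtain d1 where d1: "d1 > 0" "\<And>y. y \<noteq> x \<Longrightarrow> norm (y - x) < d1 \<Longrightarrow> \<bar>r y\<bar> \<le> (e / 2) * norm (y - x)"
      using landau_o.smallD[OF r, of "e / 2"] e unfolding eventually_at by (auto simp: dist_norm)
    obtain d2 where d2: "d2 > 0"
      "\<And>y. norm (y - x) < d2 \<Longrightarrow> norm (f y - f x - (y - x) \<bullet> g x) \<le> (e / 2) * norm (y - x)"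
      using C2_has_gradient[OF C2, of x] e unfolding has_derivative_at_alt by (meson half_gt_zero)
    show "\<exists>\<delta>>0. \<forall>\<tau>. 0 < \<bar>\<tau>\<bar> \<and> \<bar>\<tau>\<bar> < \<delta> \<longrightarrow>
        \<mu> * (\<bar>x $ i + \<tau>\<bar> - \<bar>x $ i\<bar>) \<ge> (v - g x) $ i * \<tau> - e * \<bar>\<tau>\<bar>"
    proof (intro exI[of _ "min d1 d2"] conjI allI impI)
      fix \<tau> :: real assume \<tau>: "0 < \<bar>\<tau>\<bar> \<and> \<bar>\<tau>\<bar> < min d1 d2"
      define y where "y = x + axis i \<tau>"
      have y: "y - x = axis i \<tau>" "norm (y - x) = \<bar>\<tau>\<bar>" "y \<noteq> x"
        using \<tau> by (auto simp: y_def norm_eq_sqrt_inner inner_axis_axis axis_eq_0_iff)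
      have "\<bar>r y\<bar> \<le> (e / 2) * \<bar>\<tau>\<bar>" using d1(2)[of y] y \<tau> by simp
      moreover have "\<bar>f y - f x - (y - x) \<bullet> g x\<bar> \<le> (e / 2) * \<bar>\<tau>\<bar>" using d2(2)[of y] y \<tau> by simp
      moreover have "f y + \<mu> * norm1 y \<ge> f x + \<mu> * norm1 x + v \<bullet> (y - x) + r y"
        using sub[of y] by (simp add: F_eq)
      moreover have "\<mu> * (norm1 y - norm1 x) = \<mu> * (\<bar>x $ i + \<tau>\<bar> - \<bar>x $ i\<bar>)"
        by (simp only: y_def norm1_add_axis)
      moreover have "v \<bullet> (y - x) = v $ i * \<tau>" "(y - x) \<bullet> g x = g x $ i * \<tau>"
        unfolding y(1) by (simp_all add: inner_axis inner_axis' mult.commute)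
      ultimately show "\<mu> * (\<bar>x $ i + \<tau>\<bar> - \<bar>x $ i\<bar>) \<ge> (v - g x) $ i * \<tau> - e * \<bar>\<tau>\<bar>"
        unfolding vector_minus_component left_diff_distrib right_diff_distrib abs_le_iff by linarith
    qed (use d1 d2 in auto)
  qed
  then show "v - g x \<in> l1_subgradients \<mu> x" by (simp add: l1_subgradients_def)
qed

lemma limiting_subdiff_eq: "limiting_subdiff F x = {v. v - g x \<in> l1_subgradients \<mu> x}"
proof (intro equalityI subsetI CollectI)
  fix v assume "v \<in> limiting_subdiff F x"
  then obtain xs vs where lim: "xs \<longlonglongrightarrow> x" "vs \<longlonglongrightarrow> v"
    and "\<And>k. vs k \<in> regular_subdiff F (xs k)" by (auto simp: limiting_subdiff_def)
  then have sub: "abs_subgradient \<mu> (xs k $ i) ((vs k - g (xs k)) $ i)" for k i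
    by (simp add: regular_subdiff_eq l1_subgradients_def)
  have "abs_subgradient \<mu> (x $ i) ((v - g x) $ i)" for i
  proof -
    have s: "(\<lambda>k. (vs k - g (xs k)) $ i) \<longlonglongrightarrow> (v - g x) $ i"
      and x: "(\<lambda>k. xs k $ i) \<longlonglongrightarrow> x $ i"
      by (intro tendsto_intros lim tendsto_gradient)+
    have "\<bar>(v - g x) $ i\<bar> \<le> \<mu>"
      using sub by (intro LIMSEQ_le_const2[OF tendsto_rabs[OF s]]) (auto simp: abs_subgradient_def)
    moreover have "(v - g x) $ i * x $ i = \<mu> * \<bar>x $ i\<bar>"
    proof (rule LIMSEQ_unique)
      show "(\<lambda>k. (vs k - g (xs k)) $ i * xs k $ i) \<longlonglongrightarrow> (v - g x) $ i * x $ i"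
        by (intro tendsto_mult s x)
      show "(\<lambda>k. (vs k - g (xs k)) $ i * xs k $ i) \<longlonglongrightarrow> \<mu> * \<bar>x $ i\<bar>"
        using sub unfolding abs_subgradient_def by (auto intro!: tendsto_mult_left tendsto_rabs x)
    qed
    ultimately show ?thesis by (simp add: abs_subgradient_def)
  qed
  then show "v - g x \<in> l1_subgradients \<mu> x" by (simp add: l1_subgradients_def)
next
  fix v assume "v \<in> {v. v - g x \<in> l1_subgradients \<mu> x}"
  then have "v \<in> regular_subdiff F x" by (simp add: regular_subdiff_eq)
  then show "v \<in> limiting_subdiff F x"
    unfolding limiting_subdiff_def
    by (intro CollectI exI[of _ "\<lambda>_. x"] exI[of _ "\<lambda>_. v"]) simp
qed

end

section \<open>Tangents to the graph of the subdifferential\<close>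

text \<open>The tangent cone at a point \<open>(a, c)\<close> of the broken line that is the graph of
  \<open>\<mu> \<partial>\<bar>\<cdot>\<bar>\<close>. The cases are the horizontal branches, the interior of the vertical segment and the two
  corners; \<open>c = - \<mu>\<close> corresponds to the index set \<open>K\<^sup>+\<close> of the proposition, \<open>c = \<mu>\<close> to \<open>K\<^sup>-\<close>.\<close>

definition abs_tangent :: "real \<Rightarrow> real \<Rightarrow> real \<Rightarrow> real \<Rightarrow> real \<Rightarrow> bool" where
  "abs_tangent \<mu> a c w u \<longleftrightarrow>
     (a \<noteq> 0 \<longrightarrow> u = 0) \<and>
     (a = 0 \<and> \<bar>c\<bar> < \<mu> \<longrightarrow> w = 0) \<and>
     (a = 0 \<and> c = - \<mu> \<longrightarrow> w \<le> 0 \<and> u \<ge> 0 \<and> w * u = 0) \<and>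
     (a = 0 \<and> c = \<mu> \<longrightarrow> w \<ge> 0 \<and> u \<le> 0 \<and> w * u = 0)"

lemma abs_tangent_corner_of_sequence:
  assumes "\<mu> > 0" and t: "\<And>k. t k > 0" "t \<longlonglongrightarrow> 0" and w: "w \<longlonglongrightarrow> w0" and u: "u \<longlonglongrightarrow> u0"
    and sub: "\<And>k. abs_subgradient \<mu> (t k * w k) (- \<mu> + t k * u k)"
  shows "w0 \<le> 0 \<and> u0 \<ge> 0 \<and> w0 * u0 = 0"
proof -
  have u_ge: "u k \<ge> 0" for k
  proof -
    have "0 \<le> t k * u k" using sub[of k] by (auto simp: abs_subgradient_def)
    then show ?thesis using t(1)[of k] by (simp add: zero_le_mult_iff)
  qed
  have "(\<lambda>k. - \<mu> + t k * u k) \<longlonglongrightarrow> - \<mu> + 0 * u0" using t u by (intro tendsto_intros)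
  then have "\<forall>\<^sub>F k in sequentially. - \<mu> + t k * u k < \<mu>"
    using \<open>\<mu> > 0\<close> by (intro order_tendstoD(2)[of _ "- \<mu> + 0 * u0"]) auto
  then have w_le: "\<forall>\<^sub>F k in sequentially. w k \<le> 0"
  proof eventually_elim
    case (elim k)
    then have "\<not> 0 < t k * w k" using abs_subgradient_pos[OF sub[of k]] by linarith
    then show ?case using t(1)[of k] by (simp add: zero_less_mult_iff)
  qed
  then have "\<forall>\<^sub>F k in sequentially. w k * u k = 0"
  proof eventually_elim
    case (elim k)
    show ?case
    proof (cases "w k = 0")
      case False
      with elim have "t k * w k < 0" using t(1)[of k] by (simp add: mult_pos_neg)
      from abs_subgradient_neg[OF sub this] show ?thesis using t(1)[of k] by simp
    qed simp
  qed
  then have "(\<lambda>k. w k * u k) \<longlonglongrightarrow> 0" by (rule tendsto_eventually)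
  then have "w0 * u0 = 0" using tendsto_mult[OF w u] by (rule LIMSEQ_unique[symmetric])
  moreover have "w0 \<le> 0" using w_le by (intro tendsto_upperbound[OF w]) auto
  moreover have "u0 \<ge> 0" using u_ge by (intro LIMSEQ_le_const[OF u]) auto
  ultimately show ?thesis by simp
qed

lemma abs_tangent_of_sequence:
  assumes "\<mu> > 0" and t: "\<And>k. t k > 0" "t \<longlonglongrightarrow> 0" and w: "w \<longlonglongrightarrow> w0" and u: "u \<longlonglongrightarrow> u0"
    and c: "abs_subgradient \<mu> a c"
    and sub: "\<And>k. abs_subgradient \<mu> (a + t k * w k) (c + t k * u k)"
  shows "abs_tangent \<mu> a c w0 u0"
  unfolding abs_tangent_def
proof (intro conjI impI)
  have "(\<lambda>k. a + t k * w k) \<longlonglongrightarrow> a + 0 * w0" "(\<lambda>k. c + t k * u k) \<longlonglongrightarrow> c + 0 * u0"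
    by (intro tendsto_intros t w u)+
  then have lim: "(\<lambda>k. a + t k * w k) \<longlonglongrightarrow> a" "(\<lambda>k. c + t k * u k) \<longlonglongrightarrow> c" by simp_all
  show "u0 = 0" if "a \<noteq> 0"
  proof -
    have "\<forall>\<^sub>F k in sequentially. u k = 0"
    proof (cases "a > 0")
      case True
      from order_tendstoD(1)[OF lim(1) True] show ?thesis
      proof eventually_elim
        case (elim k)
        with True have "c = \<mu>" "c + t k * u k = \<mu>"
          by (auto intro: abs_subgradient_pos c sub)
        then show ?case using t(1)[of k] by simp
      qed
    next
      case False
      with that have "a < 0" by simp
      from order_tendstoD(2)[OF lim(1) this] show ?thesis
      proof eventually_elim
        case (elim k)
        with \<open>a < 0\<close> have "c = - \<mu>" "c + t k * u k = - \<mu>"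
          by (auto intro: abs_subgradient_neg c sub)
        then show ?case using t(1)[of k] by simp
      qed
    qed
    then show ?thesis using u tendsto_eventually LIMSEQ_unique by metis
  qed
  show "w0 = 0" if "a = 0 \<and> \<bar>c\<bar> < \<mu>"
  proof -
    have "\<forall>\<^sub>F k in sequentially. \<bar>c + t k * u k\<bar> < \<mu>"
      using that by (intro order_tendstoD(2)[OF tendsto_rabs[OF lim(2)]]) auto
    then have "\<forall>\<^sub>F k in sequentially. w k = 0"
    proof eventually_elim
      case (elim k)
      then have "a + t k * w k = 0"
        using abs_subgradient_pos[OF sub[of k]] abs_subgradient_neg[OF sub[of k]] by force
      then show ?case using t(1)[of k] that by simp
    qed
    then show ?thesis using w tendsto_eventually LIMSEQ_unique by metis
  qed
  { assume "a = 0 \<and> c = - \<mu>"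
    then show "w0 \<le> 0" "u0 \<ge> 0" "w0 * u0 = 0"
      using abs_tangent_corner_of_sequence[OF \<open>\<mu> > 0\<close> t w u] sub by auto }
  { assume *: "a = 0 \<and> c = \<mu>"
    (* The point reflection of the graph exchanges the two corners. *)
    have "abs_subgradient \<mu> (t k * (- w k)) (- \<mu> + t k * (- u k))" for k
      using abs_subgradient_minus[OF sub[of k]] * by simp
    from abs_tangent_corner_of_sequence[OF \<open>\<mu> > 0\<close> t tendsto_minus[OF w] tendsto_minus[OF u] this]
    show "w0 \<ge> 0" "u0 \<le> 0" "w0 * u0 = 0" by auto }
qed

lemma abs_tangent_recession:
  assumes "\<mu> > 0" and t: "\<And>k. t k > 0" "t \<longlonglongrightarrow> 0"
    and c: "abs_subgradient \<mu> a c" and T: "abs_tangent \<mu> a c w u"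
  shows "\<forall>\<^sub>F k in sequentially. abs_subgradient \<mu> (a + t k * w) (c + t k * u)"
proof -
  have "(\<lambda>k. a + t k * w) \<longlonglongrightarrow> a + 0 * w" "(\<lambda>k. c + t k * u) \<longlonglongrightarrow> c + 0 * u"
    by (intro tendsto_intros t)+
  then have lim: "(\<lambda>k. a + t k * w) \<longlonglongrightarrow> a" "(\<lambda>k. c + t k * u) \<longlonglongrightarrow> c" by simp_all
  have ev: "\<forall>\<^sub>F k in sequentially. \<bar>c + t k * u\<bar> < \<mu>" if "\<bar>c\<bar> < \<mu>"
    using that by (intro order_tendstoD(2)[OF tendsto_rabs[OF lim(2)]]) auto
  consider "a > 0" | "a < 0" | "a = 0" "\<bar>c\<bar> < \<mu>" | "a = 0" "c = - \<mu>" | "a = 0" "c = \<mu>"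
    using c by (fastforce simp: abs_subgradient_def)
  then show ?thesis
  proof cases
    case 1
    have "u = 0" "c = \<mu>" using 1 T abs_subgradient_pos[OF c] by (auto simp: abs_tangent_def)
    from order_tendstoD(1)[OF lim(1) 1] show ?thesis
      by eventually_elim (use \<open>\<mu> > 0\<close> \<open>u = 0\<close> \<open>c = \<mu>\<close> in \<open>simp add: abs_subgradient_def\<close>)
  next
    case 2
    have "u = 0" "c = - \<mu>" using 2 T abs_subgradient_neg[OF c] by (auto simp: abs_tangent_def)
    from order_tendstoD(2)[OF lim(1) 2] show ?thesis
      by eventually_elim (use \<open>\<mu> > 0\<close> \<open>u = 0\<close> \<open>c = - \<mu>\<close> in \<open>simp add: abs_subgradient_def algebra_simps\<close>)
  next
    case 3
    then have "w = 0" using T by (simp add: abs_tangent_def)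
    from ev[OF 3(2)] show ?thesis
      by eventually_elim (use 3 \<open>w = 0\<close> in \<open>simp add: abs_subgradient_def\<close>)
  next
    case 4
    then have wu: "w \<le> 0" "u \<ge> 0" "w = 0 \<or> u = 0" using T \<open>\<mu> > 0\<close> by (auto simp: abs_tangent_def)
    from order_tendstoD(2)[OF lim(2), of \<mu>] 4 \<open>\<mu> > 0\<close>
    have "\<forall>\<^sub>F k in sequentially. c + t k * u < \<mu>" by simp
    then show ?thesis
    proof eventually_elim
      case (elim k)
      have "t k * u \<ge> 0" "t k * w \<le> 0" using wu t(1)[of k] by (auto simp: mult_nonneg_nonpos)
      with elim 4 wu show ?case by (auto simp: abs_subgradient_def)
    qed
  next
    case 5
    then have wu: "w \<ge> 0" "u \<le> 0" "w = 0 \<or> u = 0" using T \<open>\<mu> > 0\<close> by (auto simp: abs_tangent_def)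
    from order_tendstoD(1)[OF lim(2), of "- \<mu>"] 5 \<open>\<mu> > 0\<close>
    have "\<forall>\<^sub>F k in sequentially. - \<mu> < c + t k * u" by simp
    then show ?thesis
    proof eventually_elim
      case (elim k)
      have "t k * u \<le> 0" "t k * w \<ge> 0" using wu t(1)[of k] by (auto simp: mult_nonneg_nonpos)
      with elim 5 wu show ?case by (auto simp: abs_subgradient_def)
    qed
  qed
qed

locale l1_critical = l1_composite f F \<mu> for f F :: "real^'n \<Rightarrow> real" and \<mu> :: real +
  fixes xb :: "real^'n"
  assumes critical: "0 \<in> limiting_subdiff F xb"
begin

abbreviation "H \<equiv> hessian f xb"

lemma critical_coordinate: "abs_subgradient \<mu> (xb $ i) (- (g xb $ i))"
  using critical by (simp add: limiting_subdiff_eq l1_subgradients_def)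

lemma idxJ_eq: "idxJ f \<mu> xb = {i. xb $ i \<noteq> 0}"
proof -
  have "g xb $ i + \<mu> * sgn (xb $ i) = 0" if "xb $ i \<noteq> 0" for i
    using that abs_subgradient_pos[OF critical_coordinate[of i]]
      abs_subgradient_neg[OF critical_coordinate[of i]] by (auto simp: sgn_if)
  then show ?thesis by (auto simp: idxJ_def)
qed

lemma KL_system_iff:
  "KL_system f \<mu> xb w v \<longleftrightarrow>
    (\<forall>i. abs_tangent \<mu> (xb $ i) (- (g xb $ i)) (w $ i) ((v - H *v w) $ i))"
proof -
  have "- g xb $ i = \<mu> \<longleftrightarrow> g xb $ i = - \<mu>" "\<bar>- g xb $ i\<bar> < \<mu> \<longleftrightarrow> - \<mu> < g xb $ i \<and> g xb $ i < \<mu>" for i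
    by auto
  then show ?thesis
    unfolding KL_system_def Let_def idxJ_eq idxI_def idxKp_def idxKm_def abs_tangent_def
    by (simp only: mem_Collect_eq Ball_def neg_equal_iff_equal vector_minus_component
        diff_ge_0_iff_ge diff_le_0_iff_le right_minus_eq) blast
qed

lemma KL_system_inner:
  assumes "KL_system f \<mu> xb w v"
  shows "v \<bullet> w = (H *v w) \<bullet> w"
proof -
  have "(v - H *v w) $ i * w $ i = 0" for i
  proof (cases "xb $ i = 0")
    case True
    then have "\<bar>g xb $ i\<bar> \<le> \<mu>" using critical_coordinate[of i] by (simp add: abs_subgradient_def)
    then consider "\<bar>g xb $ i\<bar> < \<mu>" | "g xb $ i = \<mu>" | "g xb $ i = - \<mu>" by linarith
    then show ?thesis
      using assms True unfolding KL_system_iff abs_tangent_def by cases (auto simp: mult.commute)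
  qed (use assms in \<open>auto simp: KL_system_iff abs_tangent_def\<close>)
  then have "(v - H *v w) \<bullet> w = 0" unfolding inner_vec_def inner_real_def by (intro sum.neutral) blast
  then show ?thesis by (simp add: inner_diff_left)
qed

lemma KL_system_of_sequence:
  assumes t: "\<And>k. t k > 0" "t \<longlonglongrightarrow> 0" and w: "w \<longlonglongrightarrow> w0" and z: "z \<longlonglongrightarrow> z0"
    and v: "\<And>k. t k *\<^sub>R z k \<in> limiting_subdiff F (xb + t k *\<^sub>R w k)"
  shows "KL_system f \<mu> xb w0 z0"
  unfolding KL_system_iff
proof
  fix i
  define u where "u k = z k - (g (xb + t k *\<^sub>R w k) - g xb) /\<^sub>R t k" for k
  have u: "u \<longlonglongrightarrow> z0 - H *v w0"
    unfolding u_def[abs_def]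
    by (intro tendsto_diff z directional_derivative_along_sequence[OF C2_has_hessian[OF C2] t w])
  have "abs_subgradient \<mu> (xb $ i + t k * w k $ i) (- (g xb $ i) + t k * u k $ i)" for k
  proof -
    have "- g xb + t k *\<^sub>R u k = t k *\<^sub>R z k - g (xb + t k *\<^sub>R w k)"
      using t(1)[of k] by (simp add: u_def scaleR_diff_right)
    then have "- g xb + t k *\<^sub>R u k \<in> l1_subgradients \<mu> (xb + t k *\<^sub>R w k)"
      using v[of k] by (simp add: limiting_subdiff_eq)
    then have "abs_subgradient \<mu> ((xb + t k *\<^sub>R w k) $ i) ((- g xb + t k *\<^sub>R u k) $ i)"
      by (simp add: l1_subgradients_def)
    then show ?thesis by simp
  qed
  then show "abs_tangent \<mu> (xb $ i) (- (g xb $ i)) (w0 $ i) ((z0 - H *v w0) $ i)"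
    by (rule abs_tangent_of_sequence[OF mu_pos t tendsto_vec_nth[OF w] tendsto_vec_nth[OF u]
          critical_coordinate])
qed

text \<open>Conversely, a solution \<open>(w, z)\<close> of the system is realised along the straight line
  \<open>xb + t w\<close>: since the scalar graphs are polygonal, the \<open>l\<^sub>1\<close>-part \<open>- g xb + t (z - H w)\<close> stays a
  subgradient for small \<open>t\<close>, and only the gradient of \<open>f\<close> has to be updated.\<close>

definition line_subgradient :: "real^'n \<Rightarrow> real^'n \<Rightarrow> real \<Rightarrow> real^'n" where
  "line_subgradient w z t = g (xb + t *\<^sub>R w) - g xb + t *\<^sub>R (z - H *v w)"

lemma line_subgradient_in_subdiff:
  assumes t: "\<And>k. t k > 0" "t \<longlonglongrightarrow> 0" and "KL_system f \<mu> xb w z"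
  shows "\<forall>\<^sub>F k in sequentially. line_subgradient w z (t k) \<in> limiting_subdiff F (xb + t k *\<^sub>R w)"
proof -
  have "\<forall>\<^sub>F k in sequentially. abs_subgradient \<mu> (xb $ i + t k * w $ i) (- (g xb $ i) + t k * (z - H *v w) $ i)" for i
    using assms by (intro abs_tangent_recession[OF mu_pos t critical_coordinate]) (simp add: KL_system_iff)
  then have "\<forall>\<^sub>F k in sequentially. \<forall>i. abs_subgradient \<mu> (xb $ i + t k * w $ i) (- (g xb $ i) + t k * (z - H *v w) $ i)"
    by (rule eventually_all_finite)
  then show ?thesis
    by eventually_elim (simp add: limiting_subdiff_eq line_subgradient_def l1_subgradients_def)
qed

lemma line_subgradient_quotient:
  assumes t: "\<And>k. t k > 0" "t \<longlonglongrightarrow> 0"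
  shows "(\<lambda>k. line_subgradient w z (t k) /\<^sub>R t k) \<longlonglongrightarrow> z"
proof -
  have "(\<lambda>k. (g (xb + t k *\<^sub>R w) - g xb) /\<^sub>R t k + (z - H *v w)) \<longlonglongrightarrow> H *v w + (z - H *v w)"
    by (intro tendsto_add tendsto_const directional_derivative_along_sequence[OF C2_has_hessian[OF C2] t])
  moreover have "line_subgradient w z (t k) /\<^sub>R t k = (g (xb + t k *\<^sub>R w) - g xb) /\<^sub>R t k + (z - H *v w)" for k
    using t(1)[of k] by (simp add: line_subgradient_def scaleR_add_right)
  ultimately show ?thesis by simp
qed

lemma graphical_deriv_subdiff_iff:
  "z \<in> graphical_deriv (limiting_subdiff F) xb 0 w \<longleftrightarrow> KL_system f \<mu> xb w z"
proof
  assume "z \<in> graphical_deriv (limiting_subdiff F) xb 0 w"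
  then obtain t ws where t: "\<And>k. t k > 0" "t \<longlonglongrightarrow> 0" and ws: "ws \<longlonglongrightarrow> (w, z)"
    and mem: "\<And>k. (xb, 0) + t k *\<^sub>R ws k \<in> gph (limiting_subdiff F)"
    by (auto simp: graphical_deriv_def tangent_cone_def)
  have "t k *\<^sub>R snd (ws k) \<in> limiting_subdiff F (xb + t k *\<^sub>R fst (ws k))" for k
    using mem[of k] by (cases "ws k") (simp add: gph_def)
  from KL_system_of_sequence[OF t tendsto_fst[OF ws] tendsto_snd[OF ws] this]
  show "KL_system f \<mu> xb w z" by simp
next
  assume S: "KL_system f \<mu> xb w z"
  define t where "t k = 1 / real (Suc k)" for k
  have t: "\<And>k. t k > 0" "t \<longlonglongrightarrow> 0" unfolding t_def[abs_def] by (simp, rule LIMSEQ_Suc[OF lim_1_over_n])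
  obtain N where N: "\<And>k. k \<ge> N \<Longrightarrow> line_subgradient w z (t k) \<in> limiting_subdiff F (xb + t k *\<^sub>R w)"
    using line_subgradient_in_subdiff[OF t S] by (auto simp: eventually_sequentially)
  define t' where "t' k = t (k + N)" for k
  have t': "\<And>k. t' k > 0" "t' \<longlonglongrightarrow> 0"
    using t LIMSEQ_ignore_initial_segment[OF t(2)] by (simp_all add: t'_def[abs_def])
  have "(\<lambda>k. (w, line_subgradient w z (t' k) /\<^sub>R t' k)) \<longlonglongrightarrow> (w, z)"
    by (intro tendsto_Pair tendsto_const line_subgradient_quotient t')
  moreover have "(xb, 0) + t' k *\<^sub>R (w, line_subgradient w z (t' k) /\<^sub>R t' k) \<in> gph (limiting_subdiff F)" for k
    using N[of "k + N"] t(1)[of "k + N"] by (simp add: gph_def t'_def)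
  ultimately show "z \<in> graphical_deriv (limiting_subdiff F) xb 0 w"
    using t' by (auto simp: graphical_deriv_def tangent_cone_def intro!: exI[of _ t']
        exI[of _ "\<lambda>k. (w, line_subgradient w z (t' k) /\<^sub>R t' k)"])
qed

lemma isolation_cond_iff_KL_system: "isolation_cond f \<mu> xb \<longleftrightarrow> (\<forall>w. KL_system f \<mu> xb w 0 \<longrightarrow> w = 0)"
  unfolding isolation_cond_def KL_system_def Let_def by simp

lemma isolated_critical_iff:
  "setvalued_inverse (graphical_deriv (limiting_subdiff F) xb 0) 0 = {0} \<longleftrightarrow> isolation_cond f \<mu> xb"
proof -
  have "KL_system f \<mu> xb 0 0" by (simp add: KL_system_def)
  then show ?thesis
    by (auto simp: isolation_cond_iff_KL_system setvalued_inverse_def graphical_deriv_subdiff_iff)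
qed

section \<open>Growth of the function along sequences\<close>

text \<open>Near \<open>xb\<close> the signs of the nonzero coordinates of \<open>xb\<close> persist, so a subgradient of the norm at
  a nearby point is active at \<open>xb\<close> as well and the norm is affine between the two points.\<close>

lemma l1_norm_difference:
  assumes xs: "xs \<longlonglongrightarrow> xb" and s: "\<And>k. s k \<in> l1_subgradients \<mu> (xs k)"
  shows "\<forall>\<^sub>F k in sequentially. \<mu> * norm1 (xs k) - \<mu> * norm1 xb = s k \<bullet> (xs k - xb)"
proof -
  have sub: "abs_subgradient \<mu> (xs k $ i) (s k $ i)" for k i using s by (simp add: l1_subgradients_def)
  have "\<forall>\<^sub>F k in sequentially. abs_subgradient \<mu> (xb $ i) (s k $ i)" for i
  proof -
    have lim: "(\<lambda>k. xs k $ i) \<longlonglongrightarrow> xb $ i" using xs by (rule tendsto_vec_nth)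
    consider "xb $ i = 0" | "xb $ i > 0" | "xb $ i < 0" by linarith
    then show ?thesis
    proof cases
      case 1
      then show ?thesis using sub by (simp add: abs_subgradient_def)
    next
      case 2
      from order_tendstoD(1)[OF lim this] show ?thesis
      proof eventually_elim
        case (elim k)
        from abs_subgradient_pos[OF sub elim] 2 mu_pos show ?case by (simp add: abs_subgradient_def)
      qed
    next
      case 3
      from order_tendstoD(2)[OF lim this] show ?thesis
      proof eventually_elim
        case (elim k)
        from abs_subgradient_neg[OF sub elim] 3 mu_pos show ?case by (simp add: abs_subgradient_def)
      qed
    qed
  qed
  then have "\<forall>\<^sub>F k in sequentially. \<forall>i. abs_subgradient \<mu> (xb $ i) (s k $ i)"
    by (rule eventually_all_finite)
  then show ?thesis
  proof eventually_elim
    case (elim k)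
    then have "s k \<bullet> xb = \<mu> * norm1 xb" by (intro inner_l1_subgradient) (simp add: l1_subgradients_def)
    then show ?case by (simp add: inner_diff_right inner_l1_subgradient[OF s])
  qed
qed

lemma value_quotient_minus_slope:
  assumes t: "\<And>k. t k > 0" "t \<longlonglongrightarrow> 0" and w: "w \<longlonglongrightarrow> w0"
    and v: "\<And>k. v k \<in> limiting_subdiff F (xb + t k *\<^sub>R w k)"
  shows "(\<lambda>k. (F (xb + t k *\<^sub>R w k) - F xb) / (t k)\<^sup>2 - (v k /\<^sub>R t k) \<bullet> w k) \<longlonglongrightarrow> - ((H *v w0) \<bullet> w0) / 2"
proof -
  define x where "x k = xb + t k *\<^sub>R w k" for k
  have "x \<longlonglongrightarrow> xb + 0 *\<^sub>R w0" unfolding x_def[abs_def] by (intro tendsto_intros t w)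
  then have x: "x \<longlonglongrightarrow> xb" by simp
  have "v k - g (x k) \<in> l1_subgradients \<mu> (x k)" for k
    using v by (simp add: limiting_subdiff_eq x_def)
  from l1_norm_difference[OF x this]
  have "\<forall>\<^sub>F k in sequentially. (F (x k) - F xb) / (t k)\<^sup>2 - (v k /\<^sub>R t k) \<bullet> w k
      = (f (x k) - f xb - t k * (g xb \<bullet> w k)) / (t k)\<^sup>2 - ((g (x k) - g xb) /\<^sub>R t k) \<bullet> w k"
  proof eventually_elim
    case (elim k)
    have "F (x k) - F xb = f (x k) - f xb + (v k - g (x k)) \<bullet> (x k - xb)"
      using elim by (simp add: F_eq)
    also have "\<dots> = (f (x k) - f xb - t k * (g xb \<bullet> w k)) + t k * (v k \<bullet> w k - (g (x k) - g xb) \<bullet> w k)"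
      by (simp add: x_def inner_diff_left algebra_simps)
    finally have E: "F (x k) - F xb = \<dots>" .
    have "(a + s * (b - d)) / s\<^sup>2 - inverse s * b = a / s\<^sup>2 - inverse s * d" if "s > 0" for a b d s :: real
      using that by (simp add: field_simps power2_eq_square)
    from this[OF t(1)] show ?case unfolding inner_scaleR_left E .
  qed
  moreover have "(\<lambda>k. (f (x k) - f xb - t k * (g xb \<bullet> w k)) / (t k)\<^sup>2 - ((g (x k) - g xb) /\<^sub>R t k) \<bullet> w k)
      \<longlonglongrightarrow> ((H *v w0) \<bullet> w0) / 2 - (H *v w0) \<bullet> w0"
    unfolding x_def
    by (intro tendsto_diff tendsto_inner C2_taylor_along_sequence[OF C2 t w] w
        directional_derivative_along_sequence[OF C2_has_hessian[OF C2] t w])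
  ultimately have "(\<lambda>k. (F (x k) - F xb) / (t k)\<^sup>2 - (v k /\<^sub>R t k) \<bullet> w k) \<longlonglongrightarrow> ((H *v w0) \<bullet> w0) / 2 - (H *v w0) \<bullet> w0"
    using tendsto_cong by fastforce
  then show ?thesis by (simp add: x_def)
qed

text \<open>The slope term contributes \<open>z0 \<bullet> w0 = H w0 \<bullet> w0\<close> by complementarity, hence the factor
  one half.\<close>

lemma value_quotient_limit:
  assumes t: "\<And>k. t k > 0" "t \<longlonglongrightarrow> 0" and w: "w \<longlonglongrightarrow> w0"
    and v: "\<And>k. v k \<in> limiting_subdiff F (xb + t k *\<^sub>R w k)" and z: "(\<lambda>k. v k /\<^sub>R t k) \<longlonglongrightarrow> z0"
  shows "KL_system f \<mu> xb w0 z0"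
    and "(\<lambda>k. (F (xb + t k *\<^sub>R w k) - F xb) / (t k)\<^sup>2) \<longlonglongrightarrow> (z0 \<bullet> w0) / 2"
proof -
  show S: "KL_system f \<mu> xb w0 z0"
  proof (rule KL_system_of_sequence[OF t w z])
    show "t k *\<^sub>R (v k /\<^sub>R t k) \<in> limiting_subdiff F (xb + t k *\<^sub>R w k)" for k
      using t(1)[of k] v[of k] by simp
  qed
  show "(\<lambda>k. (F (xb + t k *\<^sub>R w k) - F xb) / (t k)\<^sup>2) \<longlonglongrightarrow> (z0 \<bullet> w0) / 2"
    using tendsto_add[OF value_quotient_minus_slope[OF t w v] tendsto_inner[OF z w]]
    by (simp add: KL_system_inner[OF S])
qed

section \<open>The modulus of the Kurdyka--Lojasiewicz inequality\<close>

text \<open>The bound says \<open>\<parallel>z k\<parallel>\<^sup>2 \<le> 4 (\<sigma> k)\<^sup>2 q k\<close> for \<open>z k = v k / t k\<close> and the difference quotients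
  \<open>q k\<close> of second order, and \<open>q k\<close> grows at most linearly in \<open>z k\<close>. Hence \<open>z\<close> is bounded and has a
  convergent subsequence, to which the expansion of the values applies.\<close>

lemma slope_bound_limit_along_directions:
  assumes t: "\<And>k. t k > 0" "t \<longlonglongrightarrow> 0" and w: "w \<longlonglongrightarrow> w0" "\<And>k. norm (w k) = 1"
    and v: "\<And>k. v k \<in> limiting_subdiff F (xb + t k *\<^sub>R w k)" and \<sigma>: "\<sigma> \<longlonglongrightarrow> \<sigma>0"
    and bound: "\<And>k. (norm (v k))\<^sup>2 \<le> 4 * (\<sigma> k)\<^sup>2 * (F (xb + t k *\<^sub>R w k) - F xb)"
  shows "\<exists>z0. KL_system f \<mu> xb w0 z0 \<and> (norm z0)\<^sup>2 \<le> 2 * \<sigma>0\<^sup>2 * (z0 \<bullet> w0)"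
proof -
  define z where "z k = v k /\<^sub>R t k" for k
  define q where "q k = (F (xb + t k *\<^sub>R w k) - F xb) / (t k)\<^sup>2" for k
  have zq: "(norm (z k))\<^sup>2 \<le> 4 * (\<sigma> k)\<^sup>2 * q k" for k
    using bound[of k] t(1)[of k] by (simp add: z_def q_def power_mult_distrib divide_simps)
  obtain C where C: "C > 0" "\<And>k. \<bar>q k - z k \<bullet> w k\<bar> \<le> C"
    using convergent_imp_Bseq[OF convergentI[OF value_quotient_minus_slope[OF t w(1) v]]]
    by (auto simp: Bseq_def q_def z_def)
  have "(\<lambda>k. 4 * (\<sigma> k)\<^sup>2) \<longlonglongrightarrow> 4 * \<sigma>0\<^sup>2" by (intro tendsto_intros \<sigma>)
  from convergent_imp_Bseq[OF convergentI[OF this]] obtain S where S: "S > 0" "\<And>k. 4 * (\<sigma> k)\<^sup>2 \<le> S"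
    by (auto simp: Bseq_def)
  have "norm (z k) \<le> S + C" for k
  proof (rule ccontr)
    assume "\<not> norm (z k) \<le> S + C"
    then have big: "norm (z k) > S + C" by simp
    have "z k \<bullet> w k \<le> norm (z k)" using norm_cauchy_schwarz[of "z k" "w k"] w(2) by simp
    then have q: "q k \<le> C + norm (z k)" using C(2)[of k] by (auto simp: abs_le_iff)
    have "0 \<le> C + norm (z k)" using C by simp
    have "(norm (z k))\<^sup>2 \<le> 4 * (\<sigma> k)\<^sup>2 * (C + norm (z k))"
      using zq[of k] mult_left_mono[OF q, of "4 * (\<sigma> k)\<^sup>2"] by simp
    also have "\<dots> \<le> S * (C + norm (z k))"
      using S(2)[of k] \<open>0 \<le> C + norm (z k)\<close> by (rule mult_right_mono)
    also have "\<dots> \<le> norm (z k) * C + S * norm (z k)"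
      using big S C by (simp add: algebra_simps)
    also have "\<dots> = (S + C) * norm (z k)" by (simp add: algebra_simps)
    also have "\<dots> < norm (z k) * norm (z k)"
      using big S C by (intro mult_strict_right_mono) auto
    finally show False by (simp add: power2_eq_square)
  qed
  then have "\<And>k. z k \<in> cball 0 (S + C)" by (simp add: dist_norm)
  then obtain z0 r where r: "strict_mono r" and z0: "(z \<circ> r) \<longlonglongrightarrow> z0"
    using compact_cball[of "0 :: real^'n" "S + C"] unfolding compact_def by meson
  note sub = LIMSEQ_subseq_LIMSEQ[OF _ r]
  have tr: "\<And>k. (t \<circ> r) k > 0" using t(1) by simp
  have vr: "\<And>k. (v \<circ> r) k \<in> limiting_subdiff F (xb + (t \<circ> r) k *\<^sub>R (w \<circ> r) k)" using v by simp
  have zr: "(\<lambda>k. (v \<circ> r) k /\<^sub>R (t \<circ> r) k) \<longlonglongrightarrow> z0" using z0 by (simp add: z_def o_def)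
  note lim = value_quotient_limit[OF tr sub[OF t(2)] sub[OF w(1)] vr zr]
  have "(norm z0)\<^sup>2 \<le> 4 * \<sigma>0\<^sup>2 * ((z0 \<bullet> w0) / 2)"
  proof (rule LIMSEQ_le)
    show "(\<lambda>k. (norm ((z \<circ> r) k))\<^sup>2) \<longlonglongrightarrow> (norm z0)\<^sup>2" by (intro tendsto_intros z0)
    show "(\<lambda>k. 4 * ((\<sigma> \<circ> r) k)\<^sup>2 * (q \<circ> r) k) \<longlonglongrightarrow> 4 * \<sigma>0\<^sup>2 * ((z0 \<bullet> w0) / 2)"
    proof (intro tendsto_mult tendsto_power tendsto_const sub[OF \<sigma>])
      show "(q \<circ> r) \<longlonglongrightarrow> (z0 \<bullet> w0) / 2" using lim(2) by (simp add: q_def o_def)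
    qed
  qed (use zq in auto)
  with lim(1) show ?thesis by (intro exI[of _ z0]) (simp add: mult_ac)
qed

text \<open>Compactness of the sphere provides a limiting direction of the points seen from \<open>xb\<close>; the
  bound on the subgradients is homogeneous of degree two in the distance and passes to the limit,
  where \<open>F (x k) - F xb\<close> is replaced by \<open>(z \<bullet> w) / 2\<close>.\<close>

lemma slope_bound_limit:
  assumes x: "x \<longlonglongrightarrow> xb" "\<And>k. F xb < F (x k)" and v: "\<And>k. v k \<in> limiting_subdiff F (x k)"
    and \<sigma>: "\<sigma> \<longlonglongrightarrow> \<sigma>0" and bound: "\<And>k. norm (v k) \<le> 2 * \<sigma> k * sqrt (F (x k) - F xb)"
  shows "\<exists>w z. KL_system f \<mu> xb w z \<and> norm w = 1 \<and> (norm z)\<^sup>2 \<le> 2 * \<sigma>0\<^sup>2 * (z \<bullet> w)"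
proof -
  define t where "t k = norm (x k - xb)" for k
  define w where "w k = (x k - xb) /\<^sub>R t k" for k
  have "x k \<noteq> xb" for k using x(2)[of k] by auto
  then have t: "t k > 0" for k by (simp add: t_def)
  have t0: "t \<longlonglongrightarrow> 0" using x(1) unfolding t_def[abs_def] by (metis LIM_zero tendsto_norm_zero)
  have w: "norm (w k) = 1" for k using t[of k] by (simp add: w_def t_def)
  have xw: "xb + t k *\<^sub>R w k = x k" for k using t[of k] by (simp add: w_def)
  have "\<And>k. w k \<in> sphere 0 1" using w by (simp add: dist_norm)
  then obtain w0 r where w0: "w0 \<in> sphere 0 1" and r: "strict_mono r" and lim: "(w \<circ> r) \<longlonglongrightarrow> w0"
    using compact_sphere[of "0 :: real^'n" 1] unfolding compact_def by meson
  note sub = LIMSEQ_subseq_LIMSEQ[OF _ r]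
  have "(norm (v k))\<^sup>2 \<le> 4 * (\<sigma> k)\<^sup>2 * (F (x k) - F xb)" for k
    using power_mono[OF bound[of k], of 2] x(2)[of k] by (simp add: power_mult_distrib)
  then have "\<exists>z0. KL_system f \<mu> xb w0 z0 \<and> (norm z0)\<^sup>2 \<le> 2 * \<sigma>0\<^sup>2 * (z0 \<bullet> w0)"
    using t w v
    by (intro slope_bound_limit_along_directions[OF _ sub[OF t0] lim _ _ sub[OF \<sigma>], where v = "v \<circ> r"])
      (simp_all add: xw)
  with w0 show ?thesis by auto
qed

end

context l1_critical
begin

text \<open>Failure of the inequality is witnessed by a subgradient, not merely by a distance; with
  \<open>\<nu> = \<infinity>\<close> the restriction on the values is void.\<close>

lemma not_KL_with_modulus_witness:
  assumes "\<sigma> > 0" "\<not> KL_with_modulus F xb (1/2) \<sigma>" "\<epsilon> > 0"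
  shows "\<exists>x v. norm (x - xb) \<le> \<epsilon> \<and> F xb < F x \<and> v \<in> limiting_subdiff F x
    \<and> norm v \<le> 2 * \<sigma> * sqrt (F x - F xb)"
proof -
  have "(0::ereal) < \<infinity>" by simp
  then have "\<not> (\<forall>x. norm (x - xb) \<le> \<epsilon> \<and> F xb < F x \<and> ereal (F x) < ereal (F xb) + \<infinity> \<longrightarrow>
      dist_set 0 (limiting_subdiff F x) \<ge> ereal (\<sigma> / (1 - 1/2) * (F x - F xb) powr (1/2)))"
    using assms unfolding KL_with_modulus_def by blast
  then obtain x where x: "norm (x - xb) \<le> \<epsilon>" "F xb < F x"
    and "\<not> dist_set 0 (limiting_subdiff F x) \<ge> ereal (\<sigma> / (1 - 1/2) * (F x - F xb) powr (1/2))"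
    by blast
  then have "dist_set 0 (limiting_subdiff F x) < ereal (2 * \<sigma> * sqrt (F x - F xb))"
    by (simp add: powr_half_sqrt not_le mult.commute)
  then obtain v where "v \<in> limiting_subdiff F x" "norm (v - 0) < 2 * \<sigma> * sqrt (F x - F xb)"
    unfolding dist_set_def INF_less_iff by auto
  with x show ?thesis by (intro exI[of _ x] exI[of _ v]) auto
qed

lemma not_KL_with_modulus_limit:
  assumes \<sigma>: "\<And>k. \<sigma> k > 0" "\<sigma> \<longlonglongrightarrow> \<sigma>0" and "\<And>k. \<not> KL_with_modulus F xb (1/2) (\<sigma> k)"
  shows "\<exists>w z. KL_system f \<mu> xb w z \<and> norm w = 1 \<and> (norm z)\<^sup>2 \<le> 2 * \<sigma>0\<^sup>2 * (z \<bullet> w)"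
proof -
  have "\<exists>x v. norm (x - xb) \<le> 1 / real (Suc k) \<and> F xb < F x \<and> v \<in> limiting_subdiff F x
    \<and> norm v \<le> 2 * \<sigma> k * sqrt (F x - F xb)" for k
    using assms by (intro not_KL_with_modulus_witness) auto
  then obtain x v where x: "\<And>k. norm (x k - xb) \<le> 1 / real (Suc k)"
    and xv: "\<And>k. F xb < F (x k)" "\<And>k. v k \<in> limiting_subdiff F (x k)"
      "\<And>k. norm (v k) \<le> 2 * \<sigma> k * sqrt (F (x k) - F xb)" by metis
  have "(\<lambda>k. x k - xb) \<longlonglongrightarrow> 0"
    using x by (intro Lim_null_comparison[OF _ LIMSEQ_Suc[OF lim_1_over_n]]) auto
  then have "x \<longlonglongrightarrow> xb" by (rule LIM_zero_cancel)
  from slope_bound_limit[OF this xv(1,2) \<sigma>(2) xv(3)] show ?thesis .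
qed

text \<open>Every solution of the system with \<open>z \<bullet> w > 0\<close> is approached along a straight line on which
  \<open>F\<close> exceeds its critical value, so it tests any inequality of this kind.\<close>

lemma KL_with_modulus_along_line:
  assumes KL: "KL_with_modulus F xb \<theta> \<sigma>" and S: "KL_system f \<mu> xb w z" and pos: "z \<bullet> w > 0"
    and t: "\<And>k. t k > 0" "t \<longlonglongrightarrow> 0"
  defines "q \<equiv> \<lambda>k. (F (xb + t k *\<^sub>R w) - F xb) / (t k)\<^sup>2"
  shows "q \<longlonglongrightarrow> (z \<bullet> w) / 2"
    and "\<forall>\<^sub>F k in sequentially. 0 < q k \<and>
      \<sigma> / (1 - \<theta>) * (q k * (t k)\<^sup>2) powr \<theta> \<le> norm (line_subgradient w z (t k))"
proof -
  have Fq: "F (xb + t k *\<^sub>R w) - F xb = q k * (t k)\<^sup>2" for k using t(1)[of k] by (simp add: q_def)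
  obtain N where N: "\<And>k. k \<ge> N \<Longrightarrow> line_subgradient w z (t k) \<in> limiting_subdiff F (xb + t k *\<^sub>R w)"
    using line_subgradient_in_subdiff[OF t S] by (auto simp: eventually_sequentially)
  define t' where "t' k = t (k + N)" for k
  have t': "\<And>k. t' k > 0" "t' \<longlonglongrightarrow> 0"
    using t LIMSEQ_ignore_initial_segment[OF t(2)] by (simp_all add: t'_def[abs_def])
  have "(\<lambda>k. (F (xb + t' k *\<^sub>R w) - F xb) / (t' k)\<^sup>2) \<longlonglongrightarrow> (z \<bullet> w) / 2"
    by (rule value_quotient_limit(2)[OF t' tendsto_const _ line_subgradient_quotient[OF t', of w]])
      (simp add: N t'_def)
  then have "(\<lambda>k. q (k + N)) \<longlonglongrightarrow> (z \<bullet> w) / 2" by (simp add: q_def t'_def)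
  then show q: "q \<longlonglongrightarrow> (z \<bullet> w) / 2" by (rule LIMSEQ_offset)
  from KL obtain \<epsilon> \<nu> where \<epsilon>: "\<epsilon> > (0::real)" and \<nu>: "\<nu> > (0::ereal)"
    and ineq: "\<And>x. norm (x - xb) \<le> \<epsilon> \<Longrightarrow> F xb < F x \<Longrightarrow> ereal (F x) < ereal (F xb) + \<nu> \<Longrightarrow>
        ereal (\<sigma> / (1 - \<theta>) * (F x - F xb) powr \<theta>) \<le> dist_set 0 (limiting_subdiff F x)"
    unfolding KL_with_modulus_def by metis
  obtain \<nu>' where \<nu>': "0 < \<nu>'" "ereal \<nu>' < \<nu>"
    using ereal_dense2[OF \<nu>] by (auto simp: zero_ereal_def)
  have ev1: "\<forall>\<^sub>F k in sequentially. 0 < q k" using pos by (intro order_tendstoD(1)[OF q]) auto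
  have "(\<lambda>k. q k * (t k)\<^sup>2) \<longlonglongrightarrow> (z \<bullet> w) / 2 * 0\<^sup>2" by (intro tendsto_intros q t)
  then have ev2: "\<forall>\<^sub>F k in sequentially. q k * (t k)\<^sup>2 < \<nu>'"
    using \<nu>' by (intro order_tendstoD(2)[of _ "(z \<bullet> w) / 2 * 0\<^sup>2"]) auto
  have "(\<lambda>k. norm (t k *\<^sub>R w)) \<longlonglongrightarrow> norm (0 *\<^sub>R w)" by (intro tendsto_intros t)
  then have ev3: "\<forall>\<^sub>F k in sequentially. norm (t k *\<^sub>R w) < \<epsilon>"
    using \<epsilon> by (intro order_tendstoD(2)[of _ "norm (0 *\<^sub>R w)"]) auto
  show "\<forall>\<^sub>F k in sequentially. 0 < q k \<and>
      \<sigma> / (1 - \<theta>) * (q k * (t k)\<^sup>2) powr \<theta> \<le> norm (line_subgradient w z (t k))"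
    using line_subgradient_in_subdiff[OF t S] ev1 ev2 ev3
  proof eventually_elim
    case (elim k)
    let ?x = "xb + t k *\<^sub>R w"
    have "0 < q k * (t k)\<^sup>2" using elim(2) t(1)[of k] by simp
    then have "F xb < F ?x" using Fq[of k] by simp
    moreover have "ereal (F ?x) < ereal (F xb) + \<nu>"
    proof -
      have "ereal (F ?x) < ereal (F xb) + ereal \<nu>'" using Fq[of k] elim(3) by simp
      also have "\<dots> \<le> ereal (F xb) + \<nu>" using \<nu>' by (intro add_left_mono) auto
      finally show ?thesis .
    qed
    ultimately have "ereal (\<sigma> / (1 - \<theta>) * (F ?x - F xb) powr \<theta>) \<le> dist_set 0 (limiting_subdiff F ?x)"
      using elim(4) by (intro ineq) auto
    also have "\<dots> \<le> ereal (norm (line_subgradient w z (t k)))"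
      unfolding dist_set_def using elim(1) by (intro INF_lower2) auto
    finally show ?case using elim(2) by (simp add: Fq)
  qed
qed

lemma KL_with_modulus_le:
  assumes KL: "KL_with_modulus F xb (1/2) \<sigma>" and S: "KL_system f \<mu> xb w z" and pos: "z \<bullet> w > 0"
  shows "\<sigma>\<^sup>2 \<le> 1 / 2 * ((norm z)\<^sup>2 / (z \<bullet> w))"
proof -
  define t where "t k = 1 / real (Suc k)" for k
  have t: "\<And>k. t k > 0" "t \<longlonglongrightarrow> 0" unfolding t_def[abs_def] by (simp, rule LIMSEQ_Suc[OF lim_1_over_n])
  define q where "q k = (F (xb + t k *\<^sub>R w) - F xb) / (t k)\<^sup>2" for k
  note * = KL_with_modulus_along_line[OF KL S pos t, folded q_def]
  have \<sigma>: "\<sigma> > 0" using KL by (simp add: KL_with_modulus_def)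
  have "\<forall>\<^sub>F k in sequentially. 2 * \<sigma> * sqrt (q k) \<le> norm (line_subgradient w z (t k) /\<^sub>R t k)"
    using *(2)
  proof eventually_elim
    case (elim k)
    have "(q k * (t k)\<^sup>2) powr (1/2) = sqrt (q k) * t k"
      using elim t(1)[of k] by (simp add: powr_half_sqrt real_sqrt_mult)
    with elim have "2 * \<sigma> * (sqrt (q k) * t k) \<le> norm (line_subgradient w z (t k))"
      by (simp add: mult_ac)
    then show ?case using t(1)[of k] by (simp add: field_simps)
  qed
  then have le: "2 * \<sigma> * sqrt ((z \<bullet> w) / 2) \<le> norm z"
    by (intro tendsto_le[OF _ tendsto_norm[OF line_subgradient_quotient[OF t]]
          tendsto_mult[OF tendsto_const tendsto_real_sqrt[OF *(1)]]]) auto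
  have "(2 * \<sigma> * sqrt ((z \<bullet> w) / 2))\<^sup>2 \<le> (norm z)\<^sup>2"
    using le \<sigma> pos by (intro power_mono) auto
  then have "4 * \<sigma>\<^sup>2 * ((z \<bullet> w) / 2) \<le> (norm z)\<^sup>2"
    using pos by (simp add: power_mult_distrib)
  then show ?thesis using pos by (simp add: field_simps)
qed

text \<open>Along the line the subgradients are of order \<open>t\<close> and the values of order \<open>t\<^sup>2\<close>, which rules
  out every exponent below one half.\<close>

lemma not_KL_property_below_half:
  assumes S: "KL_system f \<mu> xb w z" and pos: "z \<bullet> w > 0" and \<theta>: "0 \<le> \<theta>" "\<theta> < 1/2"
  shows "\<not> KL_property F xb \<theta>"
proof
  assume "KL_property F xb \<theta>"
  then obtain \<sigma> where KL: "KL_with_modulus F xb \<theta> \<sigma>" by (auto simp: KL_property_def)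
  define t where "t k = 1 / real (Suc k)" for k
  have t: "\<And>k. t k > 0" "t \<longlonglongrightarrow> 0" unfolding t_def[abs_def] by (simp, rule LIMSEQ_Suc[OF lim_1_over_n])
  define q where "q k = (F (xb + t k *\<^sub>R w) - F xb) / (t k)\<^sup>2" for k
  note * = KL_with_modulus_along_line[OF KL S pos t, folded q_def]
  have "\<forall>\<^sub>F k in sequentially. \<sigma> / (1 - \<theta>) * q k powr \<theta>
      \<le> norm (line_subgradient w z (t k) /\<^sub>R t k) * t k powr (1 - 2 * \<theta>)"
    using *(2)
  proof eventually_elim
    case (elim k)
    have "(t k)\<^sup>2 powr \<theta> = t k powr (2 * \<theta>)"
      using t(1)[of k] by (simp flip: powr_numeral add: powr_powr)
    then have "(\<sigma> / (1 - \<theta>) * q k powr \<theta>) * t k powr (2 * \<theta>) \<le> norm (line_subgradient w z (t k))"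
      using elim t(1)[of k] by (simp add: powr_mult mult.assoc)
    then have "\<sigma> / (1 - \<theta>) * q k powr \<theta> \<le> norm (line_subgradient w z (t k)) / t k powr (2 * \<theta>)"
      using t(1)[of k] by (subst pos_le_divide_eq) auto
    also have "\<dots> = norm (line_subgradient w z (t k) /\<^sub>R t k) * t k powr (1 - 2 * \<theta>)"
      using t(1)[of k] by (simp add: powr_diff)
    finally show ?case .
  qed
  moreover have "(\<lambda>k. norm (line_subgradient w z (t k) /\<^sub>R t k) * t k powr (1 - 2 * \<theta>)) \<longlonglongrightarrow> norm z * 0"
    using \<theta> t by (intro tendsto_mult tendsto_norm line_subgradient_quotient tendsto_zero_powrI[OF t(2) tendsto_const])
      (auto intro: always_eventually less_imp_le)
  moreover have "(\<lambda>k. \<sigma> / (1 - \<theta>) * q k powr \<theta>) \<longlonglongrightarrow> \<sigma> / (1 - \<theta>) * ((z \<bullet> w) / 2) powr \<theta>"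
    using pos by (intro tendsto_intros *(1)) auto
  ultimately have "\<sigma> / (1 - \<theta>) * ((z \<bullet> w) / 2) powr \<theta> \<le> norm z * 0"
    by (intro tendsto_le[OF sequentially_bot])
  moreover have "\<sigma> / (1 - \<theta>) * ((z \<bullet> w) / 2) powr \<theta> > 0"
    using KL \<theta> pos by (simp add: KL_with_modulus_def)
  ultimately show False by simp
qed

lemma KL_system_of_coneV:
  assumes "w \<in> coneV f \<mu> xb"
  shows "KL_system f \<mu> xb w (H *v w)"
  using assms by (auto simp: coneV_def KL_system_def Let_def)

text \<open>If every modulus failed, those tending to \<open>0\<close> would lead to a unit vector \<open>w\<close> that solves the
  system with \<open>z = 0\<close>.\<close>

lemma KL_property_half:
  assumes "isolation_cond f \<mu> xb"
  shows "KL_property F xb (1/2)"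
proof (rule ccontr)
  assume "\<not> KL_property F xb (1/2)"
  then have "\<not> KL_with_modulus F xb (1/2) (1 / real (Suc k))" for k by (simp add: KL_property_def)
  from not_KL_with_modulus_limit[OF _ LIMSEQ_Suc[OF lim_1_over_n] this]
  obtain w z where "KL_system f \<mu> xb w z" "norm w = 1" "(norm z)\<^sup>2 \<le> 0" by auto
  with assms show False by (auto simp: isolation_cond_iff_KL_system)
qed

lemma KL_with_modulus_of_optval:
  assumes iso: "isolation_cond f \<mu> xb" and \<sigma>: "\<sigma> > 0" "ereal (\<sigma>\<^sup>2) < KL_optval f \<mu> xb"
  shows "KL_with_modulus F xb (1/2) \<sigma>"
proof (rule ccontr)
  assume "\<not> KL_with_modulus F xb (1/2) \<sigma>"
  then obtain w z where S: "KL_system f \<mu> xb w z" "norm w = 1"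
    and le: "(norm z)\<^sup>2 \<le> 2 * \<sigma>\<^sup>2 * (z \<bullet> w)"
    using not_KL_with_modulus_limit[of "\<lambda>_. \<sigma>" \<sigma>] \<sigma>(1) by auto
  have "z \<noteq> 0" using S iso by (auto simp: isolation_cond_iff_KL_system)
  then have "0 < (norm z)\<^sup>2" by simp
  also note le
  finally have pos: "z \<bullet> w > 0" using \<sigma>(1) by (simp add: zero_less_mult_iff)
  have "KL_optval f \<mu> xb \<le> ereal (1 / 2 * ((norm z)\<^sup>2 / (z \<bullet> w)))"
    unfolding KL_optval_def using S pos by (intro INF_lower2[of "(w, z)"]) auto
  also have "\<dots> \<le> ereal (\<sigma>\<^sup>2)" using le pos by (simp add: field_simps)
  finally show False using \<sigma>(2) by simp
qed

text \<open>The moduli are known up to the borderline: all positive \<open>\<sigma>\<close> with \<open>\<sigma>\<^sup>2\<close> below the optimal value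
  are admissible, and none with \<open>\<sigma>\<^sup>2\<close> above it. The borderline does not affect the supremum.\<close>

lemma KL_modulus_eq:
  assumes iso: "isolation_cond f \<mu> xb"
  shows "KL_modulus F xb (1/2) = ereal_sqrt (KL_optval f \<mu> xb)"
proof -
  let ?S = "insert 0 (ereal ` {\<sigma>. KL_with_modulus F xb (1/2) \<sigma>})"
  have le: "ereal (\<sigma>\<^sup>2) \<le> KL_optval f \<mu> xb" if "KL_with_modulus F xb (1/2) \<sigma>" for \<sigma>
    unfolding KL_optval_def using KL_with_modulus_le[OF that] by (intro INF_greatest) auto
  obtain \<sigma>1 where \<sigma>1: "KL_with_modulus F xb (1/2) \<sigma>1"
    using KL_property_half[OF iso] by (auto simp: KL_property_def)
  have mem: "ereal \<sigma> \<le> Sup ?S" if "ereal (\<sigma>\<^sup>2) < KL_optval f \<mu> xb" for \<sigma>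
  proof (cases "\<sigma> > 0")
    case True
    then show ?thesis using KL_with_modulus_of_optval[OF iso True that] by (intro Sup_upper) auto
  next
    case False
    then have "ereal \<sigma> \<le> 0" by (simp add: zero_ereal_def)
    also have "0 \<le> Sup ?S" by (intro Sup_upper) simp
    finally show ?thesis .
  qed
  show ?thesis
  proof (cases "KL_optval f \<mu> xb")
    case (real r)
    have "\<sigma>1\<^sup>2 \<le> r" using le[OF \<sigma>1] real by simp
    then have "0 \<le> r" using zero_le_power2[of \<sigma>1] by linarith
    have "Sup ?S = ereal (sqrt r)"
    proof (rule antisym)
      show "Sup ?S \<le> ereal (sqrt r)"
        using le real \<open>0 \<le> r\<close> by (intro Sup_least) (auto simp: zero_ereal_def intro!: real_le_rsqrt)
      show "ereal (sqrt r) \<le> Sup ?S"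
      proof (rule dense_le)
        fix y assume y: "y < ereal (sqrt r)"
        show "y \<le> Sup ?S"
        proof (cases "y \<le> 0")
          case True
          also have "0 \<le> Sup ?S" by (intro Sup_upper) simp
          finally show ?thesis .
        next
          case False
          then obtain a where a: "y = ereal a" "0 < a" "a < sqrt r"
            using y by (cases y) (auto simp: zero_ereal_def)
          then have "a\<^sup>2 < (sqrt r)\<^sup>2" by (intro power_strict_mono) auto
          then have "ereal (a\<^sup>2) < KL_optval f \<mu> xb" using \<open>0 \<le> r\<close> real by simp
          then show ?thesis using mem a(1) by simp
        qed
      qed
    qed
    then show ?thesis by (simp add: KL_modulus_def real ereal_sqrt_def)
  next
    case PInf
    have "Sup ?S = \<infinity>"
      by (rule ereal_top) (use mem PInf in auto)
    then show ?thesis by (simp add: KL_modulus_def PInf ereal_sqrt_def)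
  next
    case MInf
    then show ?thesis using le[OF \<sigma>1] by simp
  qed
qed

end

section \<open>Positive eigenvalues of self-adjoint maps and principal submatrices\<close>

text \<open>A positive semidefinite form vanishes only on its kernel: otherwise the form would be negative
  at a small step from the zero in the direction of steepest descent.\<close>

lemma psd_form_zero_imp_kernel:
  fixes C :: "'a::real_inner \<Rightarrow> 'a"
  assumes "linear C" and sym: "\<And>x y. C x \<bullet> y = x \<bullet> C y"
    and psd: "\<And>x. C x \<bullet> x \<ge> 0" and zero: "C w \<bullet> w = 0"
  shows "C w = 0"
proof (rule ccontr)
  assume "C w \<noteq> 0"
  interpret C: linear C by fact
  define p where "p = (norm (C w))\<^sup>2"
  define b where "b = C (C w) \<bullet> C w"
  have "p > 0" using \<open>C w \<noteq> 0\<close> by (simp add: p_def)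
  have b: "b \<ge> 0" by (simp add: b_def psd)
  define s where "s = p / (b + 1)"
  have s: "s > 0" "s * (b + 1) = p" using \<open>p > 0\<close> b by (simp_all add: s_def)
  have "0 \<le> C (w - s *\<^sub>R C w) \<bullet> (w - s *\<^sub>R C w)" by (rule psd)
  also have "\<dots> = C w \<bullet> w - 2 * s * p + s * s * b"
    using sym[of "C w" w] unfolding p_def b_def power2_norm_eq_inner
    by (simp add: C.diff C.scaleR inner_diff_left inner_diff_right inner_commute algebra_simps)
  also have "\<dots> = s * (s * b - 2 * p)" by (simp add: zero algebra_simps)
  finally have "0 \<le> s * b - 2 * p" using s(1) by (simp add: zero_le_mult_iff)
  moreover have "s * b < p" using s by (simp add: algebra_simps)
  ultimately show False using \<open>p > 0\<close> by simp
qed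

text \<open>This replaces an eigenbasis expansion. If the form \<open>\<parallel>A w\<parallel>\<^sup>2 - l (A w \<bullet> w)\<close> of \<open>A\<^sup>2 - l A\<close> had
  a negative minimum \<open>m\<close> on the unit sphere, a minimiser would be an eigenvector of \<open>A\<^sup>2 - l A\<close> for
  \<open>m\<close>. The roots of \<open>r\<^sup>2 - l r - m\<close> are real, because \<open>\<parallel>A w - (l / 2) w\<parallel>\<^sup>2 \<ge> 0\<close> at the minimiser, and lie
  strictly between \<open>0\<close> and \<open>l\<close>; factoring shows that one of them is an eigenvalue of \<open>A\<close>.\<close>

lemma selfadjoint_no_eigenvalue_below:
  fixes A :: "'a::euclidean_space \<Rightarrow> 'a"
  assumes "linear A" and sym: "\<And>x y. A x \<bullet> y = x \<bullet> A y" and l: "l > 0"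
    and no_eig: "\<And>r u. 0 < r \<Longrightarrow> r < l \<Longrightarrow> A u = r *\<^sub>R u \<Longrightarrow> u = 0"
  shows "l * (A w \<bullet> w) \<le> (norm (A w))\<^sup>2"
proof -
  interpret A: linear A by fact
  define q where "q x = (norm (A x))\<^sup>2 - l * (A x \<bullet> x)" for x
  have q_scale: "q (c *\<^sub>R x) = c\<^sup>2 * q x" for c x
    by (simp add: q_def A.scaleR power_mult_distrib algebra_simps power2_eq_square)
  have "continuous_on (sphere 0 1) q"
    unfolding q_def by (intro continuous_intros linear_continuous_on linear_linear[THEN iffD2] assms(1))
  moreover have "sphere (0::'a) 1 \<noteq> {}" by simp
  ultimately obtain w0 where w0: "w0 \<in> sphere 0 1" and min: "\<And>x. x \<in> sphere 0 1 \<Longrightarrow> q w0 \<le> q x"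
    using continuous_attains_inf[OF compact_sphere, of "0::'a" 1 q] by auto
  define m where "m = q w0"
  have n0: "norm w0 = 1" using w0 by simp
  have q_ge: "m * (norm x)\<^sup>2 \<le> q x" for x
  proof (cases "x = 0")
    case False
    have "m \<le> q (inverse (norm x) *\<^sub>R x)" unfolding m_def using False by (intro min) simp
    also have "\<dots> = q x / (norm x)\<^sup>2" by (simp add: q_scale power_inverse divide_inverse mult.commute)
    finally show ?thesis using False by (simp add: pos_le_divide_eq)
  qed (simp add: q_def A.zero)
  have "m \<ge> 0"
  proof (rule ccontr)
    assume "\<not> m \<ge> 0"
    then have m: "m < 0" by simp
    define C where "C x = A (A x) - l *\<^sub>R A x - m *\<^sub>R x" for x
    have C_form: "C x \<bullet> x = q x - m * (norm x)\<^sup>2" for x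
      using sym[of "A x" x]
      by (simp add: C_def q_def inner_diff_left power2_norm_eq_inner)
    have "linear C"
      unfolding C_def by (intro linear_compose_sub linear_compose[OF assms(1) assms(1), unfolded o_def]
          linear_compose_scale_right linear_id[unfolded id_def] assms(1))
    moreover have "C x \<bullet> y = x \<bullet> C y" for x y
      by (simp add: C_def inner_diff_left inner_diff_right sym)
    moreover have "C x \<bullet> x \<ge> 0" for x using q_ge by (simp add: C_form)
    moreover have "C w0 \<bullet> w0 = 0" by (simp add: C_form n0 m_def)
    ultimately have C0: "C w0 = 0" by (rule psd_form_zero_imp_kernel)
    have "0 \<le> (norm (A w0 - (l / 2) *\<^sub>R w0))\<^sup>2" by simp
    also have "\<dots> = m + l\<^sup>2 / 4"
      using n0 unfolding m_def q_def power2_norm_eq_inner norm_eq_1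
      by (simp add: inner_diff_left inner_diff_right inner_commute power2_eq_square algebra_simps)
    finally have disc: "0 \<le> m + l\<^sup>2 / 4" .
    define s where "s = sqrt (m + l\<^sup>2 / 4)"
    have s2: "s\<^sup>2 = m + l\<^sup>2 / 4" using disc by (simp add: s_def)
    have "s\<^sup>2 < (l / 2)\<^sup>2" using m s2 by (simp add: power_divide)
    moreover have "s \<ge> 0" using disc by (simp add: s_def)
    ultimately have s: "s \<ge> 0" "s < l / 2"
      using l power_less_imp_less_base[of s 2 "l / 2"] by simp_all
    define u where "u = A w0 - (l / 2 - s) *\<^sub>R w0"
    have "A u - (l / 2 + s) *\<^sub>R u = A (A w0) - l *\<^sub>R A w0 + (l\<^sup>2 / 4 - s\<^sup>2) *\<^sub>R w0"
      by (simp add: u_def A.diff A.add A.scaleR algebra_simps power2_eq_square flip: scaleR_2)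
    also have "\<dots> = C w0" by (simp add: s2 C_def)
    finally have "A u = (l / 2 + s) *\<^sub>R u" using C0 by simp
    then have "u = 0" using s l by (intro no_eig[of "l / 2 + s"]) auto
    then have "A w0 = (l / 2 - s) *\<^sub>R w0" by (simp add: u_def)
    then have "w0 = 0" using s l by (intro no_eig[of "l / 2 - s"]) auto
    with n0 show False by simp
  qed
  then have "0 \<le> q w" using q_ge[of w] by (meson mult_nonneg_nonneg order_trans zero_le_power2)
  then show ?thesis by (simp add: q_def)
qed

text \<open>Eigenvectors for distinct eigenvalues are orthogonal, hence linearly independent.\<close>

lemma finite_eigenvalues_selfadjoint:
  fixes A :: "'a::euclidean_space \<Rightarrow> 'a"
  assumes sym: "\<And>x y. A x \<bullet> y = x \<bullet> A y"
  shows "finite {l. \<exists>u. u \<noteq> 0 \<and> A u = l *\<^sub>R u}" (is "finite ?E")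
proof -
  have "\<forall>l\<in>?E. \<exists>u. u \<noteq> 0 \<and> A u = l *\<^sub>R u" by simp
  from bchoice[OF this] obtain e where e': "\<forall>l\<in>?E. e l \<noteq> 0 \<and> A (e l) = l *\<^sub>R e l" ..
  note e = bspec[OF e']
  have orth: "orthogonal (e l) (e l')" if "l \<in> ?E" "l' \<in> ?E" "l \<noteq> l'" for l l'
  proof -
    have "l * (e l \<bullet> e l') = A (e l) \<bullet> e l'" using e[OF that(1)] by simp
    also have "\<dots> = e l \<bullet> A (e l')" by (rule sym)
    also have "\<dots> = l' * (e l \<bullet> e l')" using e[OF that(2)] by simp
    finally show ?thesis using that(3) by (simp add: orthogonal_def)
  qed
  have inj: "inj_on e ?E"
  proof (rule inj_onI, rule ccontr)
    fix l l' assume *: "l \<in> ?E" "l' \<in> ?E" "e l = e l'" "l \<noteq> l'"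
    from orth[OF *(1,2,4)] have "e l = 0" unfolding *(3)[symmetric] orthogonal_self .
    with e[OF *(1)] show False by blast
  qed
  have "pairwise orthogonal (e ` ?E)" using orth by (fastforce simp: pairwise_def)
  moreover have "0 \<notin> e ` ?E" using e by force
  ultimately have "independent (e ` ?E)" by (rule pairwise_orthogonal_independent)
  then have "finite (e ` ?E)" by (rule independent_bound[THEN conjunct1])
  then show ?thesis using inj by (rule finite_imageD)
qed

definition restrict_vec :: "'n set \<Rightarrow> real^'n \<Rightarrow> real^'n" where
  "restrict_vec J w = (\<chi> i. if i \<in> J then w $ i else 0)"

text \<open>A principal submatrix as a map of the whole space into itself, so that facts about self-adjoint
  maps apply; the complementary coordinates only add the eigenvalue \<open>0\<close>.\<close>

definition compression :: "'n set \<Rightarrow> real^'n^'n \<Rightarrow> real^'n \<Rightarrow> real^'n" where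
  "compression J A w = restrict_vec J (A *v restrict_vec J w)"

lemma restrict_vec_nth [simp]: "restrict_vec J w $ i = (if i \<in> J then w $ i else 0)"
  by (simp add: restrict_vec_def)

lemma restrict_vec_eq: "(\<And>i. i \<notin> J \<Longrightarrow> w $ i = 0) \<Longrightarrow> restrict_vec J w = w"
  by (simp add: vec_eq_iff)

lemma inner_restrict_vec: "restrict_vec J x \<bullet> y = x \<bullet> restrict_vec J y"
  by (simp add: inner_vec_def if_distrib cong: if_cong sum.cong) (auto intro!: sum.cong)

lemma norm_restrict_vec_le: "norm (restrict_vec J x) \<le> norm x"
  by (rule norm_le_componentwise_cart) simp

lemma linear_compression: "linear (compression J A)"
  by (rule linearI) (auto simp: compression_def vec_eq_iff matrix_vector_mult_def
      sum.distrib[symmetric] sum_distrib_left algebra_simps intro!: sum.cong)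

lemma compression_selfadjoint:
  assumes "\<And>x y. (A *v x) \<bullet> y = x \<bullet> (A *v y)"
  shows "compression J A x \<bullet> y = x \<bullet> compression J A y"
  by (simp add: compression_def inner_restrict_vec assms)

lemma matrix_vector_mult_supported:
  assumes "\<And>i. i \<notin> J \<Longrightarrow> w $ i = 0"
  shows "(A *v w) $ i = (\<Sum>j\<in>J. A $ i $ j * w $ j)"
  unfolding matrix_vector_mult_def using assms
  by (simp, intro sum.mono_neutral_right) auto

lemma eigenvalue_on_iff_compression:
  assumes "l \<noteq> 0"
  shows "eigenvalue_on J A l \<longleftrightarrow> (\<exists>u. u \<noteq> 0 \<and> compression J A u = l *\<^sub>R u)"
proof
  assume "eigenvalue_on J A l"
  then obtain u where u: "\<exists>i\<in>J. u i \<noteq> 0" "\<And>i. i \<in> J \<Longrightarrow> (\<Sum>j\<in>J. A $ i $ j * u j) = l * u i"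
    by (auto simp: eigenvalue_on_def)
  define x where "x = restrict_vec J (vec_lambda u)"
  have "x \<noteq> 0" using u(1) by (auto simp: x_def vec_eq_iff)
  moreover have "compression J A x = l *\<^sub>R x"
    using u(2) matrix_vector_mult_supported[of J x A]
    by (simp add: vec_eq_iff compression_def x_def restrict_vec_eq)
  ultimately show "\<exists>u. u \<noteq> 0 \<and> compression J A u = l *\<^sub>R u" by blast
next
  assume "\<exists>u. u \<noteq> 0 \<and> compression J A u = l *\<^sub>R u"
  then obtain u where u: "u \<noteq> 0" "\<And>i. compression J A u $ i = l * u $ i"
    by (auto simp: vec_eq_iff)
  have u0: "u $ i = 0" if "i \<notin> J" for i
    using u(2)[of i] that \<open>l \<noteq> 0\<close> by (simp add: compression_def)
  then have "\<exists>i\<in>J. u $ i \<noteq> 0" using u(1) by (auto simp: vec_eq_iff)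
  moreover have "(\<Sum>j\<in>J. A $ i $ j * u $ j) = l * u $ i" if "i \<in> J" for i
    using u(2)[of i] that matrix_vector_mult_supported[OF u0, of J A i]
    by (simp add: compression_def restrict_vec_eq u0)
  ultimately show "eigenvalue_on J A l" unfolding eigenvalue_on_def by (intro exI[of _ "\<lambda>i. u $ i"]) simp
qed

text \<open>The submatrix is completed by the identity outside \<open>J\<close> to a square matrix on the whole space,
  so that the equivalence of injectivity and invertibility applies.\<close>

lemma nonsingular_on_iff:
  "nonsingular_on J A \<longleftrightarrow>
    (\<forall>w. (\<forall>i. i \<notin> J \<longrightarrow> w $ i = 0) \<and> (\<forall>i\<in>J. (A *v w) $ i = 0) \<longrightarrow> w = 0)" (is "_ \<longleftrightarrow> ?inj")
proof
  assume "nonsingular_on J A"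
  then obtain B where B: "\<And>i j. i \<in> J \<Longrightarrow> j \<in> J \<Longrightarrow> (\<Sum>k\<in>J. B i k * A $ k $ j) = (if i = j then 1 else 0)"
    unfolding nonsingular_on_def by metis
  show ?inj
  proof (intro allI impI)
    fix w assume w: "(\<forall>i. i \<notin> J \<longrightarrow> w $ i = 0) \<and> (\<forall>i\<in>J. (A *v w) $ i = 0)"
    have "w $ i = 0" if i: "i \<in> J" for i
    proof -
      have "w $ i = (\<Sum>j\<in>J. if i = j then w $ j else 0)" using i by (subst sum.delta') auto
      also have "\<dots> = (\<Sum>j\<in>J. (\<Sum>k\<in>J. B i k * A $ k $ j) * w $ j)" using i by (intro sum.cong) (simp_all add: B)
      also have "\<dots> = (\<Sum>k\<in>J. B i k * (\<Sum>j\<in>J. A $ k $ j * w $ j))"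
        by (simp add: sum_distrib_left sum_distrib_right mult.assoc) (rule sum.swap)
      also have "\<dots> = (\<Sum>k\<in>J. B i k * (A *v w) $ k)"
        using w matrix_vector_mult_supported[of J w A] by (intro sum.cong) auto
      also have "\<dots> = 0" using w by simp
      finally show ?thesis .
    qed
    with w show "w = 0" by (auto simp: vec_eq_iff)
  qed
next
  assume inj: ?inj
  define A' where "A' = (\<chi> i j. if i \<in> J \<and> j \<in> J then A $ i $ j else if i = j then 1 else (0::real))"
  have on: "(\<Sum>k\<in>UNIV. A' $ i $ k * c k) = (\<Sum>k\<in>J. A $ i $ k * c k)" if "i \<in> J" for i c
  proof -
    have "(\<Sum>k\<in>UNIV. A' $ i $ k * c k) = (\<Sum>k\<in>J. A' $ i $ k * c k)"
      using that by (intro sum.mono_neutral_right) (auto simp: A'_def)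
    then show ?thesis using that by (simp add: A'_def)
  qed
  have on': "(\<Sum>k\<in>UNIV. c k * A' $ k $ j) = (\<Sum>k\<in>J. c k * A $ k $ j)" if "j \<in> J" for j c
  proof -
    have "(\<Sum>k\<in>UNIV. c k * A' $ k $ j) = (\<Sum>k\<in>J. c k * A' $ k $ j)"
      using that by (intro sum.mono_neutral_right) (auto simp: A'_def)
    then show ?thesis using that by (simp add: A'_def)
  qed
  have "w = 0" if w: "A' *v w = 0" for w
  proof -
    have w0: "w $ i = 0" if "i \<notin> J" for i
    proof -
      have "(A' *v w) $ i = (\<Sum>j\<in>UNIV. if i = j then w $ j else 0)"
        using that unfolding matrix_vector_mult_def vec_lambda_beta
        by (intro sum.cong) (auto simp: A'_def)
      also have "\<dots> = w $ i" by (subst sum.delta') auto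
      finally show ?thesis using w by simp
    qed
    moreover have "(A *v w) $ i = 0" if "i \<in> J" for i
      using w on[OF that, of "\<lambda>k. w $ k"] matrix_vector_mult_supported[OF w0, of J A i]
      by (simp add: matrix_vector_mult_def vec_eq_iff)
    ultimately show ?thesis using inj by blast
  qed
  then obtain B where BA: "B ** A' = mat 1" using matrix_left_invertible_ker by blast
  then have AB: "A' ** B = mat 1" by (simp add: matrix_left_right_inverse)
  show "nonsingular_on J A"
    unfolding nonsingular_on_def
  proof (intro exI[of _ "\<lambda>i j. B $ i $ j"] ballI conjI)
    fix i j assume ij: "i \<in> J" "j \<in> J"
    have "(A' ** B) $ i $ j = (if i = j then 1 else 0)" by (simp add: AB mat_def)
    then show "(\<Sum>k\<in>J. A $ i $ k * B $ k $ j) = (if i = j then 1 else 0)"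
      by (simp add: matrix_matrix_mult_def on[OF ij(1)])
    have "(B ** A') $ i $ j = (if i = j then 1 else 0)" by (simp add: BA mat_def)
    then show "(\<Sum>k\<in>J. B $ i $ k * A $ k $ j) = (if i = j then 1 else 0)"
      by (simp add: matrix_matrix_mult_def on'[OF ij(2)])
  qed
qed

section \<open>Nondegenerate critical points\<close>

context l1_critical
begin

text \<open>In a degenerate coordinate the interval of subgradients has \<open>0\<close> as an endpoint, so the
  subdifferential contains a vector no negative multiple of which it contains.\<close>

lemma no_degenerate_index_of_rel_interior:
  assumes ri: "0 \<in> rel_interior (limiting_subdiff F xb)"
  shows "idxKp f \<mu> xb \<union> idxKm f \<mu> xb = {}"
proof (rule ccontr)
  let ?S = "limiting_subdiff F xb"
  assume "idxKp f \<mu> xb \<union> idxKm f \<mu> xb \<noteq> {}"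
  then obtain j where j: "xb $ j = 0" "\<bar>g xb $ j\<bar> = \<mu>"
    using mu_pos by (auto simp: idxKp_def idxKm_def)
  define v where "v = axis j (2 * g xb $ j)"
  have "v \<in> ?S"
    unfolding limiting_subdiff_eq l1_subgradients_def mem_Collect_eq
  proof
    fix i show "abs_subgradient \<mu> (xb $ i) ((v - g xb) $ i)"
      using critical_coordinate[of i] j by (cases "i = j") (auto simp: v_def axis_def abs_subgradient_def)
  qed
  obtain e where e: "e > 0" "ball 0 e \<inter> affine hull ?S \<subseteq> ?S"
    using ri by (auto simp: mem_rel_interior_ball)
  define \<delta> where "\<delta> = e / (norm v + 1)"
  have n: "norm v + 1 > 0" by (simp add: add_nonneg_pos)
  then have \<delta>: "\<delta> > 0" using e by (simp add: \<delta>_def)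
  have "\<delta> * norm v < \<delta> * (norm v + 1)" using \<delta> by simp
  also have "\<dots> = e" using n by (simp add: \<delta>_def)
  finally have "(- \<delta>) *\<^sub>R v \<in> ball 0 e" using \<delta> by (simp add: dist_norm)
  moreover have "(1 + \<delta>) *\<^sub>R 0 + (- \<delta>) *\<^sub>R v \<in> affine hull ?S"
    using \<open>v \<in> ?S\<close> critical by (intro mem_affine[OF affine_affine_hull]) (auto intro: hull_inc)
  ultimately have "(- \<delta>) *\<^sub>R v \<in> ?S" using e by auto
  then have "abs_subgradient \<mu> (xb $ j) (((- \<delta>) *\<^sub>R v - g xb) $ j)"
    by (simp add: limiting_subdiff_eq l1_subgradients_def)
  then have "\<bar>(1 + 2 * \<delta>) * g xb $ j\<bar> \<le> \<mu>"
    by (simp add: v_def abs_subgradient_def abs_minus_commute algebra_simps)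
  then have "(1 + 2 * \<delta>) * \<mu> \<le> \<mu>" using \<delta> j by (simp add: abs_mult)
  then have "\<delta> * \<mu> \<le> 0" by (simp add: algebra_simps)
  moreover have "\<delta> * \<mu> > 0" using \<delta> mu_pos by simp
  ultimately show False by simp
qed

lemma KL_system_nondegenerate_iff:
  assumes "idxKp f \<mu> xb \<union> idxKm f \<mu> xb = {}"
  shows "KL_system f \<mu> xb w v \<longleftrightarrow>
    (\<forall>i. i \<notin> idxJ f \<mu> xb \<longrightarrow> w $ i = 0) \<and> (\<forall>i\<in>idxJ f \<mu> xb. (H *v w) $ i = v $ i)"
proof -
  have "i \<in> idxI f \<mu> xb \<longleftrightarrow> i \<notin> idxJ f \<mu> xb" for i
  proof -
    have "\<bar>g xb $ i\<bar> \<le> \<mu>" using critical_coordinate[of i] by (simp add: abs_subgradient_def)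
    moreover have "i \<notin> idxKp f \<mu> xb" "i \<notin> idxKm f \<mu> xb" using assms by auto
    ultimately show ?thesis by (auto simp: idxJ_eq idxI_def idxKp_def idxKm_def)
  qed
  moreover have "idxKp f \<mu> xb = {}" "idxKm f \<mu> xb = {}" using assms by auto
  ultimately show ?thesis by (auto simp: KL_system_def Let_def)
qed

lemma isolation_cond_iff_nonsingular:
  assumes "idxKp f \<mu> xb \<union> idxKm f \<mu> xb = {}"
  shows "isolation_cond f \<mu> xb \<longleftrightarrow> nonsingular_on (idxJ f \<mu> xb) H"
  unfolding isolation_cond_iff_KL_system KL_system_nondegenerate_iff[OF assms] nonsingular_on_iff by simp

text \<open>Without degenerate indices only the components of \<open>v\<close> in \<open>J\<close> are prescribed, and the
  remaining ones are best chosen to vanish; the problem becomes the minimisation of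
  \<open>\<parallel>A w\<parallel>\<^sup>2 / (2 (A w \<bullet> w))\<close> for the compression \<open>A\<close> of the Hessian to \<open>J\<close>.\<close>

lemma KL_optval_nondegenerate:
  assumes K: "idxKp f \<mu> xb \<union> idxKm f \<mu> xb = {}"
  shows "KL_optval f \<mu> xb = min_pos_eigenvalue_on (idxJ f \<mu> xb) H / 2"
proof -
  let ?J = "idxJ f \<mu> xb"
  let ?A = "compression ?J H"
  define P where "P = {l. eigenvalue_on ?J H l \<and> l > 0}"
  define D where "D = {(w, v). KL_system f \<mu> xb w v \<and> (norm w)\<^sup>2 = 1 \<and> v \<bullet> w > 0}"
  have optval: "KL_optval f \<mu> xb = (INF (w, v) \<in> D. ereal (1 / 2 * ((norm v)\<^sup>2 / (v \<bullet> w))))"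
    by (simp add: KL_optval_def D_def)
  have "(H *v x) \<bullet> y = x \<bullet> (H *v y)" for x y
    using hessian_symmetric[OF C2, of xb x y] by (simp add: inner_commute)
  then have sym: "?A x \<bullet> y = x \<bullet> ?A y" for x y by (rule compression_selfadjoint)
  have P: "P \<subseteq> {l. \<exists>u. u \<noteq> 0 \<and> ?A u = l *\<^sub>R u}"
    by (auto simp: P_def eigenvalue_on_iff_compression)
  then have "finite P" using finite_eigenvalues_selfadjoint[OF sym] by (rule finite_subset)
  have feasible: "?A w \<bullet> w = v \<bullet> w" "norm (?A w) \<le> norm v" if "KL_system f \<mu> xb w v" for w v
  proof -
    have w: "restrict_vec ?J w = w" and "\<forall>i\<in>?J. (H *v w) $ i = v $ i"
      using that by (auto simp: KL_system_nondegenerate_iff[OF K] intro: restrict_vec_eq)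
    then have A: "?A w = restrict_vec ?J v" unfolding compression_def w by (simp add: vec_eq_iff)
    show "?A w \<bullet> w = v \<bullet> w" by (simp add: A inner_restrict_vec w)
    show "norm (?A w) \<le> norm v" by (simp add: A norm_restrict_vec_le)
  qed
  have bound: "l * (v \<bullet> w) \<le> (norm v)\<^sup>2"
    if "l > 0" "\<And>r. r \<in> P \<Longrightarrow> l \<le> r" "KL_system f \<mu> xb w v" for l w v
  proof -
    have "l * (?A w \<bullet> w) \<le> (norm (?A w))\<^sup>2"
    proof (rule selfadjoint_no_eigenvalue_below[OF linear_compression sym that(1)])
      fix r u assume r: "0 < r" "r < l" "?A u = r *\<^sub>R u"
      show "u = 0"
      proof (rule ccontr)
        assume "u \<noteq> 0"
        with r have "r \<in> P" by (auto simp: P_def eigenvalue_on_iff_compression)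
        from that(2)[OF this] r(2) show False by simp
      qed
    qed
    also have "\<dots> \<le> (norm v)\<^sup>2" using feasible(2)[OF that(3)] by (intro power_mono) auto
    finally show ?thesis by (simp add: feasible(1)[OF that(3)])
  qed
  show ?thesis
  proof (cases "P = {}")
    case True
    have "D = {}"
    proof (rule ccontr)
      assume "D \<noteq> {}"
      then obtain w v where wv: "KL_system f \<mu> xb w v" "v \<bullet> w > 0" by (auto simp: D_def)
      define l where "l = (norm v)\<^sup>2 / (v \<bullet> w) + 1"
      have "l > 0" using wv(2) by (simp add: l_def add_nonneg_pos)
      from bound[OF this _ wv(1)] True have "l * (v \<bullet> w) \<le> (norm v)\<^sup>2" by simp
      then show False using wv(2) by (simp add: l_def distrib_right)
    qed
    then show ?thesis
      by (simp add: optval min_pos_eigenvalue_on_def P_def[symmetric] True top_ereal_def)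
  next
    case False
    define l where "l = Min P"
    have "l \<in> P" using \<open>finite P\<close> False by (simp add: l_def)
    then have "l > 0" by (simp add: P_def)
    have "KL_optval f \<mu> xb = ereal (l / 2)"
      unfolding optval
    proof (rule antisym)
      obtain u where u: "u \<noteq> 0" "?A u = l *\<^sub>R u" using P \<open>l \<in> P\<close> by auto
      define w where "w = u /\<^sub>R norm u"
      have Aw: "?A w = l *\<^sub>R w"
        using u(2) by (simp add: w_def linear_scale[OF linear_compression])
      have w1: "norm w = 1" using u(1) by (simp add: w_def)
      have w0: "w $ i = 0" if "i \<notin> ?J" for i
        using Aw \<open>l > 0\<close> that by (auto simp: vec_eq_iff compression_def split: if_splits)
      then have "restrict_vec ?J w = w" by (rule restrict_vec_eq)
      then have "(H *v w) $ i = (l *\<^sub>R w) $ i" if "i \<in> ?J" for i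
        using that unfolding Aw[symmetric] by (simp add: compression_def)
      then have "(w, l *\<^sub>R w) \<in> D"
        using w0 w1 \<open>l > 0\<close> by (simp add: D_def KL_system_nondegenerate_iff[OF K] dot_square_norm)
      moreover have "1 / 2 * ((norm (l *\<^sub>R w))\<^sup>2 / (l *\<^sub>R w \<bullet> w)) = l / 2"
        using w1 \<open>l > 0\<close> by (simp add: dot_square_norm power2_eq_square)
      ultimately show "(INF (w, v) \<in> D. ereal (1 / 2 * ((norm v)\<^sup>2 / (v \<bullet> w)))) \<le> ereal (l / 2)"
        by (intro INF_lower2[of "(w, l *\<^sub>R w)"]) auto
      show "ereal (l / 2) \<le> (INF (w, v) \<in> D. ereal (1 / 2 * ((norm v)\<^sup>2 / (v \<bullet> w))))"
      proof (rule INF_greatest, clarify)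
        fix w v assume "(w, v) \<in> D"
        then have wv: "KL_system f \<mu> xb w v" "v \<bullet> w > 0" by (auto simp: D_def)
        have "l * (v \<bullet> w) \<le> (norm v)\<^sup>2"
          using \<open>finite P\<close> by (intro bound[OF \<open>l > 0\<close> _ wv(1)]) (simp add: l_def)
        then show "ereal (l / 2) \<le> ereal (1 / 2 * ((norm v)\<^sup>2 / (v \<bullet> w)))"
          using wv(2) by (simp add: pos_le_divide_eq)
      qed
    qed
    then show ?thesis
      using False by (simp add: min_pos_eigenvalue_on_def P_def[symmetric] l_def)
  qed
qed

end

theorem proposition5p3:
  fixes f F :: "real^'n \<Rightarrow> real" and \<mu> :: real and xb :: "real^'n"
  assumes "C2 f"
    and "\<mu> > 0"
    and "\<And>x. F x = f x + \<mu> * norm1 x"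
    and "0 \<in> limiting_subdiff F xb"
  shows
    "(setvalued_inverse (graphical_deriv (limiting_subdiff F) xb 0) 0 = {0} \<longleftrightarrow> isolation_cond f \<mu> xb)
     \<and> (setvalued_inverse (graphical_deriv (limiting_subdiff F) xb 0) 0 = {0} \<longrightarrow>
          KL_property F xb (1/2)
          \<and> ((\<exists>w \<in> coneV f \<mu> xb. (hessian f xb *v w) \<bullet> w > 0) \<longrightarrow> sharp_KL_exponent F xb (1/2))
          \<and> KL_modulus F xb (1/2) = ereal_sqrt (KL_optval f \<mu> xb))
     \<and> (0 \<in> rel_interior (limiting_subdiff F xb) \<longrightarrow>
          idxKp f \<mu> xb \<union> idxKm f \<mu> xb = {}
          \<and> (isolation_cond f \<mu> xb \<longleftrightarrow> nonsingular_on (idxJ f \<mu> xb) (hessian f xb))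
          \<and> (setvalued_inverse (graphical_deriv (limiting_subdiff F) xb 0) 0 = {0} \<longrightarrow>
               KL_optval f \<mu> xb = min_pos_eigenvalue_on (idxJ f \<mu> xb) (hessian f xb) / 2))"
proof -
  interpret l1_critical f F \<mu> xb
    using assms by unfold_locales
  have KL: "KL_property F xb (1/2)
      \<and> ((\<exists>w \<in> coneV f \<mu> xb. (H *v w) \<bullet> w > 0) \<longrightarrow> sharp_KL_exponent F xb (1/2))
      \<and> KL_modulus F xb (1/2) = ereal_sqrt (KL_optval f \<mu> xb)"
    if iso: "isolation_cond f \<mu> xb"
  proof (intro conjI impI KL_property_half KL_modulus_eq iso)
    assume "\<exists>w \<in> coneV f \<mu> xb. (H *v w) \<bullet> w > 0"
    then obtain w where w: "w \<in> coneV f \<mu> xb" "(H *v w) \<bullet> w > 0" ..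
    show "sharp_KL_exponent F xb (1/2)"
      using KL_property_half[OF iso] not_KL_property_below_half[OF KL_system_of_coneV[OF w(1)] w(2)]
      by (simp add: sharp_KL_exponent_def)
  qed
  show ?thesis
    unfolding isolated_critical_iff
  proof (intro conjI impI)
    assume "0 \<in> rel_interior (limiting_subdiff F xb)"
    note K = no_degenerate_index_of_rel_interior[OF this]
    show "idxKp f \<mu> xb \<union> idxKm f \<mu> xb = {}"
      and "isolation_cond f \<mu> xb \<longleftrightarrow> nonsingular_on (idxJ f \<mu> xb) H"
      and "KL_optval f \<mu> xb = min_pos_eigenvalue_on (idxJ f \<mu> xb) H / 2"
      using K isolation_cond_iff_nonsingular[OF K] KL_optval_nondegenerate[OF K] by simp_all
  qed (use KL in simp_all)
qed

end
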